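(* Let $\mathbb{F}_q$ be a finite field with $q$ elements and $\operatorname{char}\mathbb{F}_q\neq 2$. For $j\in\{3,4,5,6,8,14,15,16,17,18,19\}$ let $\Phi_j$ be the set of valid pairs and $\Psi_j$ the set of smooth pairs in the pencil $\mathscr{P}_j$. Let $p^{\mathrm{sm}}_j$ (respectively $p^{\mathrm{val}}_j$) be the probability that a uniformly random element of $\Psi_j$ (respectively $\Phi_j$) is a $3$-Poncelet pair. Then: \begin{itemize} \item For $j\in\{3,16\}$: if $\operatorname{char}\mathbb{F}_q\neq3$, then $p^{\mathrm{sm}}_j=\frac{q-5}{(q-2)(q-3)}$ and $p^{\mathrm{val}}_j=\frac{q-5}{q(q-2)}$; if $\operatorname{char}\mathbb{F}_q=3$, then $p^{\mathrm{sm}}_j=\frac{1}{q-2}$ for $q>3$ (for $q=3$ the set $\Psi_j$ is empty) and $p^{\mathrm{val}}_j=\frac{q-3}{q(q-2)}$. \item For $j\in\{4,15\}$: if $\operatorname{char}\mathbb{F}_q\neq3$, then $p^{\mathrm{sm}}_j=\frac{1}{q-2}$ and $p^{\mathrm{val}}_j=\frac{1}{q-1}$; if $\operatorname{char}\mathbb{F}_q=3$, then $p^{\mathrm{sm}}_j=p^{\mathrm{val}}_j=0$. \item For $j\in\{5,8\}$: if $\operatorname{char}\mathbb{F}_q\neq3$, then $p^{\mathrm{sm}}_j=p^{\mathrm{val}}_j=0$; if $\operatorname{char}\mathbb{F}_q=3$, then $p^{\mathrm{sm}}_j=p^{\mathrm{val}}_j=1$. \item For $j\in\{6,17\}$: if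 $\operatorname{char}\mathbb{F}_q\neq3$, then $p^{\mathrm{sm}}_j=p^{\mathrm{val}}_j=\frac{1}{q-2}$; if $\operatorname{char}\mathbb{F}_q=3$, then $p^{\mathrm{sm}}_j=p^{\mathrm{val}}_j=0$. \item For $j\in\{14,19\}$: $p^{\mathrm{sm}}_j=\frac1q$ and $p^{\mathrm{val}}_j=\frac{q-1}{q^2}$, in every characteristic (other than $2$). \item For $j=18$: $p^{\mathrm{sm}}_j=p^{\mathrm{val}}_j=\frac1q$ if $\operatorname{char}\mathbb{F}_q\neq3$, and $p^{\mathrm{sm}}_j=p^{\mathrm{val}}_j=\frac{1}{q+1}$ if $\operatorname{char}\mathbb{F}_q=3$. \end{itemize}
   Context: Conics. A conic in $\mathbf{P}^2(\mathbb{F}_q)$ is given by a nonzero quadratic form in $x,y,z$ over $\mathbb{F}_q$ (up to scalar), represented by its symmetric $3\times 3$ matrix; it is smooth if the matrix is invertible and singular otherwise. Singular conics are regarded over the algebraic closure $\overline{\mathbb{F}_q}$: each is either a double line or a union of two distinct lines defined over $\overline{\mathbb{F}_q}$ (a conic consisting of a single $\mathbb{F}_q$-point is the union of two conjugate lines). Pencils. The pencil $\mathscr{P}_j$ has two generators with matrices $A_j,B_j$; its elements are indexed by $\eta\in\mathbf{P}^1(\mathbb{F}_q)=\mathbb{F}_q\cup\{\infty\}$, the conic with parameter $\eta$ having matrix $C_j(\eta)=\eta A_j+B_j$, with $C_j(\infty)=A_j$. The generators (quadratic forms of $A_j$; of $B_j$) are: $\mathscr{P}_3$: $xy$; $xz+yz+z^2$.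 $\mathscr{P}_4$: $xy$; $xz+z^2$. $\mathscr{P}_5$: $xy$; $xz+y^2$. $\mathscr{P}_6$: $xy$; $z^2$. $\mathscr{P}_8$: $x^2$; $xy+z^2$. $\mathscr{P}_{14}$: $xy$; $xz+y^2+yz+ez^2$. $\mathscr{P}_{15}$: $xy$; $y^2+yz+ez^2$. $\mathscr{P}_{16}$: $xy$; $ex^2+xz+dy^2+yz+z^2$. $\mathscr{P}_{17}$: $x^2$; $y^2+yz+ez^2$. $\mathscr{P}_{18}$: $-xz+y^2$; $x^2+cxy+by^2+yz$. $\mathscr{P}_{19}$: $x^2-\nu y^2$; $2\sigma xy-\rho y^2+z^2$. Here $b,c,d,e,\nu,\rho,\sigma\in\mathbb{F}_q$ are fixed so that $T^3+bT^2+cT+1$, $T^2+T+d$, $T^2+T+e$ are irreducible in $\mathbb{F}_q[T]$, and $\nu$ and $\rho^2-4\nu\sigma^2$ are non-squares in $\mathbb{F}_q$. Pairs. A pair $(\mathscr{A},\mathscr{B})$ of conics of $\mathscr{P}_j$ (an ordered pair, identified with its pair of parameters $(r,s)$) is valid if the two conics are distinct, $\mathscr{B}$ is smooth, and $\mathscr{A}$ is either smooth or the union of two distinct lines (over $\overline{\mathbb{F}_q}$) neither of which is tangent to $\mathscr{B}$. A smooth pair is an ordered pair of distinct smooth conics of the pencil. Poncelet pairs. $(\mathscr{A},\mathscr{B})$ is an $n$-Poncelet pair if, over $\overline{\mathbb{F}_q}$, there is an $n$-sided polygon inscribed in $\mathscr{A}$ and circumscribed about $\mathscr{B}$. For $n=3$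 this is taken in the form of Cayley's criterion: if $A,B$ are the matrices of $\mathscr{A},\mathscr{B}$ and $\sqrt{\det(tA+B)}=H_0+H_1t+H_2t^2+H_3t^3+\cdots$ is the formal power series expansion over $\overline{\mathbb{F}_q}$ (either choice of square root), then $(\mathscr{A},\mathscr{B})$ is a $3$-Poncelet pair if and only if $H_2=0$. *)

theory Defs
  imports
    "HOL-Probability.Probability"
    "HOL-Algebra.Algebraic_Closure_Type"
begin

section \<open>Conics and lines\<close>

text \<open>
  A conic is represented by its symmetric matrix; the quadratic form of \<open>M\<close> at \<open>v\<close> is
  \<open>v\<^sup>T M v\<close>.
\<close>

definition quad_form :: "'a::comm_ring_1^3^3 \<Rightarrow> 'a^3 \<Rightarrow> 'a" where
  "quad_form M v = (\<Sum>i\<in>UNIV. \<Sum>j\<in>UNIV. v $ i * M $ i $ j * v $ j)"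

definition lin_form :: "'a::comm_ring_1^3 \<Rightarrow> 'a^3 \<Rightarrow> 'a" where
  "lin_form l v = (\<Sum>i\<in>UNIV. l $ i * v $ i)"

definition conic_matrix :: "'a::field \<Rightarrow> 'a \<Rightarrow> 'a \<Rightarrow> 'a \<Rightarrow> 'a \<Rightarrow> 'a \<Rightarrow> 'a^3^3" where
  "conic_matrix xx yy zz xy xz yz =
     vector [vector [xx,     xy / 2, xz / 2],
             vector [xy / 2, yy,     yz / 2],
             vector [xz / 2, yz / 2, zz]]"

lemma quad_form_conic_matrix:
  fixes x y z :: "'a::field"
  assumes "(2::'a) \<noteq> 0"
  shows "quad_form (conic_matrix xx yy zz xy xz yz) (vector [x, y, z]) =
    xx * x\<^sup>2 + yy * y\<^sup>2 + zz * z\<^sup>2 + xy * (x * y) + xz * (x * z) + yz * (y * z)"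
proof -
  define a b c where "a = xy / 2" and "b = xz / 2" and "c = yz / 2"
  with assms have "xy = 2 * a" "xz = 2 * b" "yz = 2 * c"
    by (simp_all add: mult.commute)
  with assms show ?thesis
    by (simp add: quad_form_def conic_matrix_def sum_3 vector_3 algebra_simps power2_eq_square)
qed

definition smooth_conic :: "'a::field^3^3 \<Rightarrow> bool" where
  "smooth_conic M \<longleftrightarrow> invertible M"

definition over_closure :: "'a::field^3^3 \<Rightarrow> 'a alg_closure^3^3" where
  "over_closure M = (\<chi> i j. to_ac (M $ i $ j))"

text \<open>
  A line is given by a nonzero covector up to scalar. That a conic is, as a curve, the union of
  two lines means that its quadratic form is the product of the two linear forms.
\<close>

definition union_of_distinct_lines :: "'k::field^3^3 \<Rightarrow> 'k^3 \<Rightarrow> 'k^3 \<Rightarrow> bool" where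
  "union_of_distinct_lines M l m \<longleftrightarrow>
     l \<noteq> 0 \<and> m \<noteq> 0 \<and> (\<nexists>c. m = c *s l) \<and>
     (\<forall>v. quad_form M v = lin_form l v * lin_form m v)"

text \<open>
  The tangent line of a smooth conic at one of its points \<open>p\<close> has the equation \<open>p\<^sup>T M v = 0\<close>,
  the gradient of the quadratic form at \<open>p\<close> being \<open>2 M p\<close>.
\<close>

definition tangent_line :: "'k::field^3^3 \<Rightarrow> 'k^3 \<Rightarrow> bool" where
  "tangent_line M l \<longleftrightarrow>
     (\<exists>p c. p \<noteq> 0 \<and> quad_form M p = 0 \<and> c \<noteq> 0 \<and> l = c *s (M *v p))"


section \<open>Pairs of conics and Cayley's criterion\<close>

definition valid_conics :: "'a::field^3^3 \<Rightarrow> 'a^3^3 \<Rightarrow> bool" where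
  "valid_conics A B \<longleftrightarrow>
     smooth_conic B \<and>
     (smooth_conic A \<or>
      (\<exists>l m. union_of_distinct_lines (over_closure A) l m \<and>
             \<not> tangent_line (over_closure B) l \<and> \<not> tangent_line (over_closure B) m))"

text \<open>
  The polynomial \<open>det (t A + B)\<close>, as a formal power series in \<open>t\<close>. The choice of its square root
  is irrelevant, since any two differ by a sign.
\<close>

definition cayley_det :: "'k::field^3^3 \<Rightarrow> 'k^3^3 \<Rightarrow> 'k fps" where
  "cayley_det A B = det (\<chi> i j. fps_X * fps_const (A $ i $ j) + fps_const (B $ i $ j))"

definition poncelet3 :: "'a::field^3^3 \<Rightarrow> 'a^3^3 \<Rightarrow> bool" where
  "poncelet3 A B \<longleftrightarrow>
     (\<exists>H. H\<^sup>2 = cayley_det (over_closure A) (over_closure B) \<and> fps_nth H 2 = 0)"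


section \<open>Pencils\<close>

text \<open>
  A pencil is given by its two generators, and its parameter line
  \<open>\<bbbP>\<^sup>1(\<bbbF>\<^sub>q)\<close> is modelled by the option type with \<open>None\<close> as the point at infinity.
\<close>

type_synonym 'a pencil = "('a^3^3) \<times> ('a^3^3)"

fun member :: "'a::field pencil \<Rightarrow> 'a option \<Rightarrow> 'a^3^3" where
  "member (A, B) None = A"
| "member (A, B) (Some \<eta>) = (\<chi> i j. \<eta> * A $ i $ j + B $ i $ j)"

definition valid_pairs :: "'a::field pencil \<Rightarrow> ('a option \<times> 'a option) set" where
  "valid_pairs P = {(r, s). r \<noteq> s \<and> valid_conics (member P r) (member P s)}"

definition smooth_pairs :: "'a::field pencil \<Rightarrow> ('a option \<times> 'a option) set" where
  "smooth_pairs P = {(r, s). r \<noteq> s \<and> smooth_conic (member P r) \<and> smooth_conic (member P s)}"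

text \<open>
  The uniform distribution \<^const>\<open>pmf_of_set\<close> is meaningful only on a nonempty (finite) set, so
  these probabilities are not determined when the set of pairs is empty.
\<close>

definition p_smooth :: "'a::field pencil \<Rightarrow> real" where
  "p_smooth P = measure_pmf.prob (pmf_of_set (smooth_pairs P))
     {(r, s). poncelet3 (member P r) (member P s)}"

definition p_valid :: "'a::field pencil \<Rightarrow> real" where
  "p_valid P = measure_pmf.prob (pmf_of_set (valid_pairs P))
     {(r, s). poncelet3 (member P r) (member P s)}"

text \<open>
  The arguments of \<^const>\<open>conic_matrix\<close> are the coefficients of
  \<open>x\<^sup>2, y\<^sup>2, z\<^sup>2, xy, xz, yz\<close>, in this order.
\<close>

definition pencil3 :: "'a::field pencil" where
  "pencil3 = (conic_matrix 0 0 0 1 0 0, conic_matrix 0 0 1 0 1 1)"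

definition pencil4 :: "'a::field pencil" where
  "pencil4 = (conic_matrix 0 0 0 1 0 0, conic_matrix 0 0 1 0 1 0)"

definition pencil5 :: "'a::field pencil" where
  "pencil5 = (conic_matrix 0 0 0 1 0 0, conic_matrix 0 1 0 0 1 0)"

definition pencil6 :: "'a::field pencil" where
  "pencil6 = (conic_matrix 0 0 0 1 0 0, conic_matrix 0 0 1 0 0 0)"

definition pencil8 :: "'a::field pencil" where
  "pencil8 = (conic_matrix 1 0 0 0 0 0, conic_matrix 0 0 1 1 0 0)"

definition pencil14 :: "'a::field \<Rightarrow> 'a pencil" where
  "pencil14 e = (conic_matrix 0 0 0 1 0 0, conic_matrix 0 1 e 0 1 1)"

definition pencil15 :: "'a::field \<Rightarrow> 'a pencil" where
  "pencil15 e = (conic_matrix 0 0 0 1 0 0, conic_matrix 0 1 e 0 0 1)"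

definition pencil16 :: "'a::field \<Rightarrow> 'a \<Rightarrow> 'a pencil" where
  "pencil16 d e = (conic_matrix 0 0 0 1 0 0, conic_matrix e d 1 0 1 1)"

definition pencil17 :: "'a::field \<Rightarrow> 'a pencil" where
  "pencil17 e = (conic_matrix 1 0 0 0 0 0, conic_matrix 0 1 e 0 0 1)"

definition pencil18 :: "'a::field \<Rightarrow> 'a \<Rightarrow> 'a pencil" where
  "pencil18 b c = (conic_matrix 0 1 0 0 (-1) 0, conic_matrix 1 b 0 c 0 1)"

definition pencil19 :: "'a::field \<Rightarrow> 'a \<Rightarrow> 'a \<Rightarrow> 'a pencil" where
  "pencil19 \<nu> \<rho> \<sigma> =
     (conic_matrix 1 (- \<nu>) 0 0 0 0, conic_matrix 0 (- \<rho>) 1 (2 * \<sigma>) 0 0)"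

end

theory Submission
  imports Defs
begin

text \<open>
  Let \<open>D(x, y)\<close> be the determinant of the member of a pencil with parameter \<open>(x : y)\<close>, a binary
  cubic form. For members with parameters \<open>r\<close> and \<open>s\<close> the matrix \<open>t A + B\<close> belongs to the point
  \<open>s + t r\<close>, so \<open>det (t A + B) = D(s + t r) = f\<^sub>0 + f\<^sub>1 t + f\<^sub>2 t\<^sup>2 + f\<^sub>3 t\<^sup>3\<close>, and comparing coefficients
  in \<open>H\<^sup>2 = D(s + t r)\<close> turns Cayley's condition \<open>H\<^sub>2 = 0\<close> into \<open>f\<^sub>1\<^sup>2 = 4 f\<^sub>0 f\<^sub>2\<close>
  (\<open>poncelet3_iff\<close>, \<open>poncelet3_member\<close>). Counting Poncelet pairs is therefore a question about the
  binary cubic \<open>D\<close> alone; the geometry of the pencil only decides which singular members may occur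
  as the first conic of a valid pair.

  Suppose that \<open>D\<close> has nonzero discriminant, and let \<open>k\<close> be the number of its roots on the
  projective line. For fixed \<open>s\<close> the expression \<open>f\<^sub>1\<^sup>2 - 4 f\<^sub>0 f\<^sub>2\<close> is a binary quadratic form in \<open>r\<close>
  whose discriminant is \<open>(4 D(s))\<^sup>2\<close> times the Hessian of \<open>D\<close> at \<open>s\<close>, and its value at \<open>r = s\<close>
  is \<open>-3 D(s)\<^sup>2\<close>. With \<open>\<chi>\<close> the quadratic character, a smooth \<open>s\<close> hence has \<open>1 + \<chi>(Hess s)\<close>
  partners \<open>r \<noteq> s\<close> if the characteristic is not \<open>3\<close>, and one less in characteristic \<open>3\<close>, where \<open>r = s\<close>
  is itself a zero of the form. The Hessian is a quadratic form of discriminant \<open>-3 disc D\<close>, so its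
  character sum over the projective line is \<open>0\<close> outside characteristic \<open>3\<close>; in characteristic \<open>3\<close>
  it is the square of a linear form, and the sum is \<open>q\<close>. At the \<open>k\<close> roots of \<open>D\<close> the Hessian is
  a nonzero square. Altogether there are \<open>q + 1 - 2 k\<close>, respectively \<open>q - k\<close>, pairs
  (\<open>card_cayley_pairs\<close>). No pair has a root of \<open>D\<close> as its first entry, so that this number counts
  the Poncelet pairs among the smooth pairs as well as among the valid ones. For \<open>pencil3\<close> and
  \<open>pencil16\<close> one has \<open>k = 3\<close>, for \<open>pencil14\<close> and \<open>pencil19\<close> \<open>k = 1\<close>, and for \<open>pencil18\<close> \<open>k = 0\<close>; in
  all of them every singular member is admissible, so only the number of all pairs differs.

  The remaining pencils have degenerate cubics. If \<open>D\<close> is a multiple of \<open>x\<^sup>2 y\<close> or \<open>x y\<^sup>2\<close> (\<open>pencil4\<close>,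
  \<open>pencil6\<close>, \<open>pencil15\<close>, \<open>pencil17\<close>), Cayley's condition for affine nonzero parameters is \<open>r = s / 4\<close> or \<open>r = 4 s\<close>,
  which gives one partner for each \<open>s\<close> unless \<open>3 = 0\<close>. If \<open>D\<close> is a multiple of \<open>y\<^sup>3\<close> (\<open>pencil5\<close>,
  \<open>pencil8\<close>), the condition reads \<open>3 = 0\<close>.

  Admissibility of singular members is decided by the dual quadratic form: a line is tangent to a
  smooth conic if and only if the form of the adjugate matrix vanishes on its covector
  (\<open>tangent_line_iff\<close>), and the two lines of a singular member are found by comparing coefficients
  (\<open>valid_conics_iff\<close>).
\<close>

section \<open>Quadratic character of a finite field\<close>

definition qchar :: "'a::field \<Rightarrow> int" where
  "qchar x = (if x = 0 then 0 else if \<exists>y. x = y\<^sup>2 then 1 else -1)"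

lemma qchar_simps:
  "qchar (0::'a::field) = 0" "qchar ((y::'a::field)\<^sup>2) = (if y = 0 then 0 else 1)"
  unfolding qchar_def by auto

lemma qchar_nonsquare: "\<nexists>y. x = y\<^sup>2 \<Longrightarrow> qchar (x::'a::field) = -1"
  by (auto simp: qchar_def)

lemma neq_0_if_nonsquare: "\<nexists>x::'a::field. t = x\<^sup>2 \<Longrightarrow> t \<noteq> 0"
  by (metis zero_power2)

lemma card_sqrts:
  fixes x :: "'a::{field,finite}"
  assumes two: "(2::'a) \<noteq> 0"
  shows "int (card {y. y\<^sup>2 = x}) = 1 + qchar x"
proof (cases "\<exists>y. x = y\<^sup>2")
  case True
  then obtain y where y: "x = y\<^sup>2" by blast
  have "{z. z\<^sup>2 = x} = {y, -y}" by (auto simp: y power2_eq_iff)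
  moreover have "y = -y \<longleftrightarrow> y = 0"
    using two by (metis add.inverse_neutral add.right_inverse mult_2 mult_eq_0_iff)
  ultimately show ?thesis by (cases "y = 0") (auto simp: qchar_simps y)
next
  case False
  then have "{y. y\<^sup>2 = x} = {}" by auto
  with False show ?thesis by (simp add: qchar_nonsquare)
qed

lemma sum_qchar:
  assumes "(2::'a::{field,finite}) \<noteq> 0"
  shows "(\<Sum>x\<in>UNIV. qchar (x::'a)) = 0"
proof -
  have "int (card (UNIV :: 'a set)) = int (card (\<Union>x. {y::'a. y\<^sup>2 = x}))"
    by (intro arg_cong[where f = "\<lambda>S. int (card S)"]) auto
  also have "\<dots> = (\<Sum>x\<in>UNIV. int (card {y::'a. y\<^sup>2 = x}))"
    by (subst card_UN_disjoint) auto
  also have "\<dots> = int (card (UNIV :: 'a set)) + (\<Sum>x\<in>UNIV. qchar (x::'a))"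
    by (simp add: card_sqrts[OF assms] sum.distrib)
  finally show ?thesis by simp
qed

lemma qchar_square_mult: "u \<noteq> 0 \<Longrightarrow> qchar (u\<^sup>2 * x) = qchar (x::'a::field)"
proof -
  assume u: "u \<noteq> 0"
  have "(\<exists>y. u\<^sup>2 * x = y\<^sup>2) \<longleftrightarrow> (\<exists>y. x = y\<^sup>2)"
  proof
    assume "\<exists>y. u\<^sup>2 * x = y\<^sup>2"
    then obtain y where "u\<^sup>2 * x = y\<^sup>2" ..
    with u have "x = (y / u)\<^sup>2" by (simp add: field_simps)
    then show "\<exists>y. x = y\<^sup>2" ..
  next
    assume "\<exists>y. x = y\<^sup>2"
    then show "\<exists>y. u\<^sup>2 * x = y\<^sup>2" by (metis power_mult_distrib)
  qed
  with u show ?thesis by (simp add: qchar_def)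
qed

text \<open>
  The point is that the product of two nonsquares is a square. This follows from the vanishing of the
  sum of all values of \<open>qchar\<close>, without the structure of the multiplicative group.
\<close>

lemma qchar_mult:
  fixes x y :: "'a::{field,finite}"
  assumes two: "(2::'a) \<noteq> 0"
  shows "qchar (x * y) = qchar x * qchar y"
proof -
  consider "x = 0" | u where "x = u\<^sup>2" "u \<noteq> 0" | "\<nexists>u. x = u\<^sup>2" "x \<noteq> 0"
    by (metis zero_power2)
  then show ?thesis
  proof cases
    case 3
    \<comment> \<open>The terms \<open>qchar (x * t) + qchar t\<close> sum to \<open>0\<close> over all \<open>t\<close> and are
      never positive, so they all vanish.\<close>
    have le: "0 \<le> - (qchar (x * t) + qchar t)" for t
    proof (cases "\<exists>u. t = u\<^sup>2")
      case True
      then obtain u where u: "t = u\<^sup>2" ..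
      show ?thesis
      proof (cases "u = 0")
        case False
        then have "qchar (x * t) = qchar x"
          by (simp add: u qchar_square_mult mult.commute[of x])
        with 3 False show ?thesis by (simp add: qchar_nonsquare u qchar_simps)
      qed (simp add: u qchar_simps)
    qed (auto simp: qchar_nonsquare qchar_def)
    have "(\<Sum>t\<in>UNIV. qchar (x * t)) = (\<Sum>t\<in>UNIV. qchar (t::'a))"
      by (rule sum.reindex_bij_witness[of _ "\<lambda>t. t / x" "\<lambda>t. x * t"]) (use 3 in auto)
    then have "(\<Sum>t\<in>UNIV. - (qchar (x * t) + qchar t)) = 0"
      by (simp add: sum_subtractf sum_qchar[OF two] sum_negf)
    then have "- (qchar (x * y) + qchar y) = 0"
      by (subst (asm) sum_nonneg_eq_0_iff) (simp, rule le, blast)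
    with 3 show ?thesis by (simp add: qchar_nonsquare)
  qed (auto simp: qchar_simps qchar_square_mult)
qed

lemma two_powers_neq_0:
  assumes "(2::'a::field) \<noteq> 0"
  shows "(4::'a) \<noteq> 0" "(8::'a) \<noteq> 0" "(16::'a) \<noteq> 0" "(64::'a) \<noteq> 0" "(256::'a) \<noteq> 0"
proof -
  have eqs: "(4::'a) = 2 * 2" "(8::'a) = 2 * 2 * 2" "(16::'a) = 2 * 2 * 2 * 2"
    "(64::'a) = 2 * 2 * 2 * 2 * 2 * 2" "(256::'a) = 2 * 2 * 2 * 2 * 2 * 2 * 2 * 2" by simp_all
  show "(4::'a) \<noteq> 0" "(8::'a) \<noteq> 0" "(16::'a) \<noteq> 0" "(64::'a) \<noteq> 0" "(256::'a) \<noteq> 0"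
    using assms by (simp_all only: eqs mult_eq_0_iff) simp_all
qed

text \<open>
  The number of points of the hyperbola \<open>x\<^sup>2 - y\<^sup>2 = n\<close> is the sum of \<open>1 + qchar (x\<^sup>2 - n)\<close>; the
  hyperbola is parametrized by the nonzero values of \<open>u = x - y\<close>, since \<open>x + y = n / u\<close>.
\<close>

lemma sum_qchar_square_diff:
  fixes n :: "'a::{field,finite}"
  assumes two: "(2::'a) \<noteq> 0" and n: "n \<noteq> 0"
  shows "(\<Sum>x\<in>UNIV. qchar (x\<^sup>2 - n)) = -1"
proof -
  have "(\<Sum>x\<in>UNIV. int (card {y::'a. y\<^sup>2 = x\<^sup>2 - n})) = int (card (SIGMA x:UNIV. {y. y\<^sup>2 = x\<^sup>2 - n}))"
    by (subst card_SigmaI) auto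
  also have "card (SIGMA x:UNIV. {y. y\<^sup>2 = x\<^sup>2 - n}) = card (UNIV - {0::'a})"
  proof (rule bij_betw_same_card)
    show "bij_betw (\<lambda>(x, y). x - y) (SIGMA x:UNIV. {y. y\<^sup>2 = x\<^sup>2 - n}) (UNIV - {0})"
    proof (rule bij_betwI[of _ _ _ "\<lambda>u. ((u + n / u) / 2, (n / u - u) / 2)"])
      show "(\<lambda>u. ((u + n / u) / 2, (n / u - u) / 2)) \<in> UNIV - {0} \<rightarrow>
          (SIGMA x:UNIV. {y. y\<^sup>2 = x\<^sup>2 - n})"
      proof
        fix u :: 'a assume "u \<in> UNIV - {0}"
        with two two_powers_neq_0(1)[OF two] have "((n / u - u) / 2)\<^sup>2 = ((u + n / u) / 2)\<^sup>2 - n"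
          by (simp add: field_simps power2_eq_square)
        then show "((u + n / u) / 2, (n / u - u) / 2) \<in> (SIGMA x:UNIV. {y. y\<^sup>2 = x\<^sup>2 - n})"
          by simp
      qed
    next
      fix p :: "'a \<times> 'a" assume p: "p \<in> (SIGMA x:UNIV. {y. y\<^sup>2 = x\<^sup>2 - n})"
      obtain x y where [simp]: "p = (x, y)" by fastforce
      have eq: "n = (x - y) * (x + y)"
        using p by (simp add: algebra_simps power2_eq_square)
      with n have "x - y \<noteq> 0" by auto
      then have "n / (x - y) = x + y" by (simp add: eq)
      then show "(\<lambda>u. ((u + n / u) / 2, (n / u - u) / 2)) (case p of (x, y) \<Rightarrow> x - y) = p"
        using two by (simp add: field_simps)
    qed (use two two_powers_neq_0(1)[OF two] n in \<open>auto simp: field_simps\<close>)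
  qed
  also have "int \<dots> = int CARD('a) - 1"
    by (simp add: card_Diff_singleton of_nat_diff Suc_leI)
  finally show ?thesis by (simp add: card_sqrts[OF two] sum.distrib)
qed

text \<open>
  In a field with exactly three elements, \<open>0\<close>, \<open>1\<close> and \<open>2\<close> are all of them, and \<open>3\<close> can only be \<open>0\<close>.
\<close>

lemma card_odd_field:
  assumes "(2::'a::{field,finite}) \<noteq> 0"
  shows "CARD('a) \<ge> 3" "CARD('a) = 3 \<Longrightarrow> (3::'a) = 0"
proof -
  have "card {0, 1, 2 :: 'a} \<le> CARD('a)" by (rule card_mono) auto
  moreover have "(2::'a) \<noteq> 1" by (metis add_cancel_right_right one_add_one zero_neq_one)
  ultimately show "CARD('a) \<ge> 3" using assms by (simp add: card_insert_if)
  show "(3::'a) = 0" if "CARD('a) = 3"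
  proof -
    have "{0, 1, 2 :: 'a} = UNIV"
      by (rule card_subset_eq) (use that assms \<open>(2::'a) \<noteq> 1\<close> in \<open>simp_all add: card_insert_if\<close>)
    then have "(3::'a) \<in> {0, 1, 2}" by blast
    moreover have "(3::'a) = 1 + 2" "(3::'a) = 2 + 1" by simp_all
    then have "(3::'a) \<noteq> 1" "(3::'a) \<noteq> 2"
      using assms by (metis add_cancel_right_right zero_neq_one)+
    ultimately show ?thesis by blast
  qed
qed

section \<open>Binary forms on the projective line\<close>

text \<open>
  Homogeneous coordinates on the projective line: \<open>Some t\<close> is the point \<open>(t : 1)\<close> and \<open>None\<close> is
  \<open>(1 : 0)\<close>. Values of a form at a point refer to this representative; whether a form vanishes, and for
  forms of even degree whether its value is a square, does not depend on that choice.
\<close>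

fun hx :: "'a::zero_neq_one option \<Rightarrow> 'a" where
  "hx None = 1" | "hx (Some t) = t"

fun hy :: "'a::zero_neq_one option \<Rightarrow> 'a" where
  "hy None = 0" | "hy (Some t) = 1"

definition qform :: "'a::field \<Rightarrow> 'a \<Rightarrow> 'a \<Rightarrow> 'a option \<Rightarrow> 'a" where
  "qform a b c r = a * (hx r)\<^sup>2 + b * hx r * hy r + c * (hy r)\<^sup>2"

lemma complete_square:
  fixes a :: "'a::comm_ring_1"
  shows "4 * a * (a * x\<^sup>2 + b * x + c) = (2 * a * x + b)\<^sup>2 - (b\<^sup>2 - 4 * a * c)"
  by (simp add: algebra_simps power2_eq_square)

lemma Collect_option:
  "{r. P r} = (if P None then {None} else {}) \<union> Some ` {t. P (Some t)}"
  by (auto simp: image_iff) (metis option.exhaust)+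

lemma card_Collect_option:
  "card {r::'a::finite option. P r} = of_bool (P None) + card {t. P (Some t)}"
  by (subst Collect_option) (auto simp: card_insert_if card_image)

lemma sum_option:
  "(\<Sum>r\<in>UNIV. f (r::'a::finite option)) = f None + (\<Sum>t\<in>UNIV. f (Some t) :: int)"
  by (subst UNIV_option_conv, subst sum.insert) (auto simp: sum.reindex)

lemma card_zeros_qform:
  fixes a b c :: "'a::{field,finite}"
  assumes two: "(2::'a) \<noteq> 0" and nz: "a \<noteq> 0 \<or> b \<noteq> 0 \<or> c \<noteq> 0"
  shows "int (card {r. qform a b c r = 0}) = 1 + qchar (b\<^sup>2 - 4 * a * c)"
proof (cases "a = 0")
  case False
  have "bij_betw (\<lambda>x. 2 * a * x + b) {x. a * x\<^sup>2 + b * x + c = 0} {y. y\<^sup>2 = b\<^sup>2 - 4 * a * c}"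
  proof (rule bij_betwI[of _ _ _ "\<lambda>y. (y - b) / (2 * a)"])
    show "(\<lambda>y. (y - b) / (2 * a)) \<in> {y. y\<^sup>2 = b\<^sup>2 - 4 * a * c} \<rightarrow> {x. a * x\<^sup>2 + b * x + c = 0}"
    proof
      fix y assume y: "y \<in> {y. y\<^sup>2 = b\<^sup>2 - 4 * a * c}"
      have "2 * a * ((y - b) / (2 * a)) + b = y" using False two by simp
      with y complete_square[of a "(y - b) / (2 * a)" b c]
      have "4 * a * (a * ((y - b) / (2 * a))\<^sup>2 + b * ((y - b) / (2 * a)) + c) = 0" by simp
      with False two_powers_neq_0(1)[OF two]
      show "(y - b) / (2 * a) \<in> {x. a * x\<^sup>2 + b * x + c = 0}" by simp
    qed
    show "(\<lambda>x. 2 * a * x + b) \<in> {x. a * x\<^sup>2 + b * x + c = 0} \<rightarrow> {y. y\<^sup>2 = b\<^sup>2 - 4 * a * c}"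
    proof
      fix x assume "x \<in> {x. a * x\<^sup>2 + b * x + c = 0}"
      with complete_square[of a x b c] show "2 * a * x + b \<in> {y. y\<^sup>2 = b\<^sup>2 - 4 * a * c}"
        by simp
    qed
  qed (use False two in auto)
  then have "card {x. a * x\<^sup>2 + b * x + c = 0} = card {y. y\<^sup>2 = b\<^sup>2 - 4 * a * c}"
    by (rule bij_betw_same_card)
  with False show ?thesis
    by (simp add: card_Collect_option qform_def card_sqrts[OF two])
next
  case a: True
  show ?thesis
  proof (cases "b = 0")
    case True
    with a nz show ?thesis by (simp add: card_Collect_option qform_def qchar_simps)
  next
    case False
    then have "{x. b * x + c = 0} = {- c / b}" by (auto simp: field_simps eq_neg_iff_add_eq_0)
    with a False show ?thesis by (simp add: card_Collect_option qform_def qchar_simps)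
  qed
qed

text \<open>
  Completing the square, the affine points contribute \<open>qchar a\<close> times the character sum of
  \<open>u\<^sup>2 - disc\<close>, which is \<open>- qchar a\<close>, and the point at infinity contributes \<open>qchar a\<close>.
\<close>

lemma sum_qchar_qform:
  fixes a b c :: "'a::{field,finite}"
  assumes two: "(2::'a) \<noteq> 0" and nz: "b\<^sup>2 - 4 * a * c \<noteq> 0"
  shows "(\<Sum>r\<in>UNIV. qchar (qform a b c r)) = 0"
proof (cases "a = 0")
  case True
  with nz have b: "b \<noteq> 0" by auto
  have "(\<Sum>x\<in>UNIV. qchar (b * x + c)) = (\<Sum>x\<in>UNIV. qchar (x::'a))"
    by (rule sum.reindex_bij_witness[of _ "\<lambda>x. (x - c) / b" "\<lambda>x. b * x + c"])
       (use b in auto)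
  with True show ?thesis by (simp add: sum_option qform_def qchar_simps sum_qchar[OF two])
next
  case False
  have "qchar (a * x\<^sup>2 + b * x + c) = qchar a * qchar ((2 * a * x + b)\<^sup>2 - (b\<^sup>2 - 4 * a * c))" for x
  proof -
    have "qchar ((2 * a)\<^sup>2 * (a * x\<^sup>2 + b * x + c)) =
        qchar (a * (4 * a * (a * x\<^sup>2 + b * x + c)))"
      by (simp add: algebra_simps power2_eq_square)
    moreover have "(2 * a) \<noteq> 0" using False two by simp
    ultimately show ?thesis
      by (simp only: complete_square qchar_mult[OF two] qchar_simps if_False mult_1)
  qed
  moreover have "(\<Sum>x\<in>UNIV. qchar ((2 * a * x + b)\<^sup>2 - (b\<^sup>2 - 4 * a * c))) =
      (\<Sum>x\<in>UNIV. qchar (x\<^sup>2 - (b\<^sup>2 - 4 * a * c)))"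
    by (rule sum.reindex_bij_witness[of _ "\<lambda>x. (x - b) / (2 * a)" "\<lambda>x. 2 * a * x + b"])
       (use False two in auto)
  ultimately show ?thesis
    by (simp add: sum_option qform_def sum_distrib_left[symmetric]
        sum_qchar_square_diff[OF two nz])
qed

section \<open>Counting Cayley pairs of a binary cubic\<close>

definition cubic :: "'a::field \<Rightarrow> 'a \<Rightarrow> 'a \<Rightarrow> 'a \<Rightarrow> 'a option \<Rightarrow> 'a" where
  "cubic a b c d r = a * hx r ^ 3 + b * (hx r)\<^sup>2 * hy r + c * hx r * (hy r)\<^sup>2 + d * hy r ^ 3"

text \<open>
  The coefficient of \<open>t\<close> in \<open>D(s + t r)\<close>, where \<open>D\<close> is the cubic form; the coefficient of \<open>t\<^sup>2\<close> is
  \<open>polar a b c d r s\<close>.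
\<close>

definition polar :: "'a::field \<Rightarrow> 'a \<Rightarrow> 'a \<Rightarrow> 'a \<Rightarrow> 'a option \<Rightarrow> 'a option \<Rightarrow> 'a" where
  "polar a b c d s r =
     (3 * a * (hx s)\<^sup>2 + 2 * b * hx s * hy s + c * (hy s)\<^sup>2) * hx r +
     (b * (hx s)\<^sup>2 + 2 * c * hx s * hy s + 3 * d * (hy s)\<^sup>2) * hy r"

text \<open>
  If \<open>D(s + t r) = f\<^sub>0 + f\<^sub>1 t + f\<^sub>2 t\<^sup>2 + f\<^sub>3 t\<^sup>3\<close>, this is \<open>f\<^sub>1\<^sup>2 - 4 f\<^sub>0 f\<^sub>2\<close>, which vanishes if and only
  if \<open>D(s + t r)\<close> agrees modulo \<open>t\<^sup>3\<close> with a constant times the square of a linear polynomial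
  (provided that \<open>f\<^sub>0 \<noteq> 0\<close>).
\<close>

definition cayley_form :: "'a::field \<Rightarrow> 'a \<Rightarrow> 'a \<Rightarrow> 'a \<Rightarrow> 'a option \<Rightarrow> 'a option \<Rightarrow> 'a" where
  "cayley_form a b c d r s = (polar a b c d s r)\<^sup>2 - 4 * cubic a b c d s * polar a b c d r s"

text \<open>The determinant of the second partial derivatives of the cubic form, divided by \<open>-4\<close>.\<close>

definition hessian :: "'a::field \<Rightarrow> 'a \<Rightarrow> 'a \<Rightarrow> 'a \<Rightarrow> 'a option \<Rightarrow> 'a" where
  "hessian a b c d = qform (b\<^sup>2 - 3 * a * c) (b * c - 9 * a * d) (c\<^sup>2 - 3 * b * d)"

definition cubic_disc :: "'a::field \<Rightarrow> 'a \<Rightarrow> 'a \<Rightarrow> 'a \<Rightarrow> 'a" where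
  "cubic_disc a b c d =
     b\<^sup>2 * c\<^sup>2 - 4 * a * c ^ 3 - 4 * b ^ 3 * d - 27 * a\<^sup>2 * d\<^sup>2 + 18 * a * b * c * d"

lemma cubic_simps:
  "cubic a b c d None = a" "cubic 0 b c d (Some x) = b * x\<^sup>2 + c * x + d"
  by (simp_all add: cubic_def)

lemma cayley_form_self: "cayley_form a b c d s s = - 3 * (cubic a b c d s)\<^sup>2"
proof -
  have "polar a b c d s s = 3 * cubic a b c d s"
    by (simp add: cubic_def polar_def algebra_simps power2_eq_square power3_eq_cube)
  then show ?thesis by (simp add: cayley_form_def algebra_simps power2_eq_square)
qed

text \<open>
  If \<open>D(r) = 0\<close> then \<open>f\<^sub>3 = 0\<close>, and \<open>f\<^sub>1\<^sup>2 = 4 f\<^sub>0 f\<^sub>2\<close> would make \<open>D(s + t r)\<close> the square of a linear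
  polynomial up to a constant, so that \<open>D\<close> would have a double root.
\<close>

lemma cayley_form_at_root:
  assumes r: "cubic a b c d r = 0" and s: "cubic a b c d s \<noteq> 0" and disc: "cubic_disc a b c d \<noteq> 0"
  shows "cayley_form a b c d r s \<noteq> 0"
proof (cases r)
  case None
  with r have "a = 0" by (simp add: cubic_def)
  with None s disc show ?thesis
    by (cases s) (auto simp: cubic_def cayley_form_def polar_def cubic_disc_def algebra_simps
        power2_eq_square power3_eq_cube)
next
  case (Some \<rho>)
  \<comment> \<open>Expanding at the root, \<open>D(\<rho> + u) = e\<^sub>1 u + e\<^sub>2 u\<^sup>2 + e\<^sub>3 u\<^sup>3\<close>.\<close>
  define e1 e2 where "e1 = 3 * a * \<rho>\<^sup>2 + 2 * b * \<rho> + c" and "e2 = 3 * a * \<rho> + b"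
  from r Some have d: "d = - (a * \<rho> ^ 3 + b * \<rho>\<^sup>2 + c * \<rho>)"
    by (simp add: cubic_def eq_neg_iff_add_eq_0 algebra_simps)
  have "cubic_disc a b c d = e1\<^sup>2 * (e2\<^sup>2 - 4 * e1 * a)"
    unfolding cubic_disc_def d e1_def e2_def
    by (simp add: algebra_simps power2_eq_square power3_eq_cube)
  with disc have "e2\<^sup>2 - 4 * e1 * a \<noteq> 0" by auto
  moreover have "cayley_form a b c d r s = (hx s - \<rho> * hy s) ^ 4 * (e2\<^sup>2 - 4 * e1 * a)"
    by (cases s) (simp_all add: Some cayley_form_def polar_def cubic_def d e1_def e2_def
        algebra_simps power2_eq_square power3_eq_cube power4_eq_xxxx)
  moreover have "hx s - \<rho> * hy s \<noteq> 0" using r s Some by (cases s) auto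
  ultimately show ?thesis by simp
qed

text \<open>
  At a root the Hessian is the square of the derivative, which is nonzero because the root is simple.
\<close>

lemma qchar_hessian_at_root:
  assumes r: "cubic a b c d r = 0" and disc: "cubic_disc a b c d \<noteq> 0"
  shows "qchar (hessian a b c d r) = 1"
proof (cases r)
  case None
  with r have "a = 0" by (simp add: cubic_def)
  with None disc show ?thesis
    by (auto simp: hessian_def qform_def cubic_disc_def qchar_simps)
next
  case (Some \<rho>)
  define e1 e2 where "e1 = 3 * a * \<rho>\<^sup>2 + 2 * b * \<rho> + c" and "e2 = 3 * a * \<rho> + b"
  from r Some have d: "d = - (a * \<rho> ^ 3 + b * \<rho>\<^sup>2 + c * \<rho>)"
    by (simp add: cubic_def eq_neg_iff_add_eq_0 algebra_simps)
  have "cubic_disc a b c d = e1\<^sup>2 * (e2\<^sup>2 - 4 * e1 * a)"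
    unfolding cubic_disc_def d e1_def e2_def
    by (simp add: algebra_simps power2_eq_square power3_eq_cube)
  with disc have "e1 \<noteq> 0" by auto
  moreover have "hessian a b c d r = e1\<^sup>2"
    by (simp add: Some hessian_def qform_def d e1_def
        algebra_simps power2_eq_square power3_eq_cube)
  ultimately show ?thesis by (simp add: qchar_simps)
qed

text \<open>
  The zeros \<open>r\<close> of the quadratic form \<open>f\<^sub>1\<^sup>2 - 4 f\<^sub>0 f\<^sub>2\<close> are counted by its discriminant. The form
  takes the value \<open>- 3 * D(s)\<^sup>2\<close> at \<open>r = s\<close>, so \<open>s\<close> has to be removed from the zeros precisely in
  characteristic \<open>3\<close>.
\<close>

lemma card_cayley_partners:
  fixes s :: "'a::{field,finite} option"
  assumes two: "(2::'a) \<noteq> 0" and f: "cubic a b c d s \<noteq> 0" and disc: "cubic_disc a b c d \<noteq> 0"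
  shows "int (card {r. r \<noteq> s \<and> cayley_form a b c d r s = 0}) =
    (if (3::'a) = 0 then 0 else 1) + qchar (hessian a b c d s)"
proof -
  \<comment> \<open>\<open>u\<close> and \<open>v\<close> are the partial derivatives of the cubic form at \<open>s\<close>.\<close>
  define f u v where "f = cubic a b c d s"
    and "u = 3 * a * (hx s)\<^sup>2 + 2 * b * hx s * hy s + c * (hy s)\<^sup>2"
    and "v = b * (hx s)\<^sup>2 + 2 * c * hx s * hy s + 3 * d * (hy s)\<^sup>2"
  define A B C where "A = u\<^sup>2 - 4 * f * (3 * a * hx s + b * hy s)"
    and "B = 2 * u * v - 8 * f * (b * hx s + c * hy s)"
    and "C = v\<^sup>2 - 4 * f * (c * hx s + 3 * d * hy s)"
  have form: "cayley_form a b c d r s = qform A B C r" for r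
    by (simp add: cayley_form_def polar_def qform_def A_def B_def C_def flip: f_def u_def v_def)
       (simp add: algebra_simps power2_eq_square)
  have "B\<^sup>2 - 4 * A * C = (4 * f)\<^sup>2 * hessian a b c d s"
    by (cases s) (simp_all add: A_def B_def C_def f_def u_def v_def cubic_def hessian_def qform_def
          algebra_simps power2_eq_square power3_eq_cube)
  moreover have "4 * f \<noteq> 0"
    using f two_powers_neq_0(1)[OF two] by (simp add: f_def)
  ultimately have chi: "qchar (B\<^sup>2 - 4 * A * C) = qchar (hessian a b c d s)"
    by (metis qchar_square_mult)
  have nz: "A \<noteq> 0 \<or> B \<noteq> 0 \<or> C \<noteq> 0"
  proof (cases "(3::'a) = 0")
    case False
    with f have "cayley_form a b c d s s \<noteq> 0" by (simp add: cayley_form_self)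
    then show ?thesis by (auto simp: form qform_def)
  next
    case three: True
    have nine: "27 = (0::'a)" "18 = (0::'a)"
      using arg_cong[OF three, of "\<lambda>t. 9 * t"] arg_cong[OF three, of "\<lambda>t. 6 * t"] by simp_all
    show ?thesis
    proof (rule ccontr)
      assume "\<not> ?thesis"
      then have z: "A = 0" "B = 0" "C = 0" by auto
      \<comment> \<open>The gradient of the quadratic form at \<open>s\<close> is \<open>- 2 f\<close> times the gradient \<open>(u, v)\<close> of the cubic.
        If the quadratic form were \<open>0\<close>, the cubic would reduce to \<open>a x\<^sup>3 + d y\<^sup>3\<close>, a cube over the
        algebraic closure.\<close>
      have "2 * A * hx s + B * hy s = - 2 * f * u" "B * hx s + 2 * C * hy s = - 2 * f * v"
        by (cases s; simp add: A_def B_def C_def f_def u_def v_def cubic_def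
          algebra_simps power2_eq_square power3_eq_cube)+
      with z f two have "u = 0" "v = 0" by (simp_all add: f_def)
      then have "b * hy s = 0" "b * hx s + c * hy s = 0" "c * hx s = 0"
        using z f two_powers_neq_0[OF two] three by (simp_all add: A_def B_def C_def f_def)
      then have "b = 0" "c = 0" by (cases s; auto)+
      with disc show False by (simp add: cubic_disc_def nine)
    qed
  qed
  have count: "int (card {r. qform A B C r = 0}) = 1 + qchar (hessian a b c d s)"
    by (simp add: card_zeros_qform[OF two nz] chi)
  show ?thesis
  proof (cases "(3::'a) = 0")
    case False
    with f have "cayley_form a b c d s s \<noteq> 0" by (simp add: cayley_form_self)
    then have "{r. r \<noteq> s \<and> cayley_form a b c d r s = 0} = {r. qform A B C r = 0}"
      by (auto simp: form)
    with False count show ?thesis by simp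
  next
    case True
    then have "cayley_form a b c d s s = 0" by (simp add: cayley_form_self)
    then have "{r. r \<noteq> s \<and> cayley_form a b c d r s = 0} = {r. qform A B C r = 0} - {s}"
      and "s \<in> {r. qform A B C r = 0}"
      by (auto simp: form)
    then have "int (card {r. r \<noteq> s \<and> cayley_form a b c d r s = 0}) =
        int (card {r. qform A B C r = 0}) - 1"
      using card_Suc_Diff1[of "{r. qform A B C r = 0}" s] by auto
    with True count show ?thesis by simp
  qed
qed

text \<open>
  The Hessian has discriminant \<open>-3\<close> times that of the cubic. In characteristic \<open>3\<close> it degenerates to
  the square of the linear form \<open>b x - c y\<close>, which has exactly one zero among \<open>q + 1\<close> points.
\<close>

lemma sum_qchar_hessian:
  fixes a b c d :: "'a::{field,finite}"
  assumes two: "(2::'a) \<noteq> 0" and disc: "cubic_disc a b c d \<noteq> 0"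
  shows "(\<Sum>s\<in>UNIV. qchar (hessian a b c d s)) = (if (3::'a) = 0 then int CARD('a) else 0)"
proof (cases "(3::'a) = 0")
  case False
  have "(b * c - 9 * a * d)\<^sup>2 - 4 * (b\<^sup>2 - 3 * a * c) * (c\<^sup>2 - 3 * b * d) = - 3 * cubic_disc a b c d"
    by (simp add: cubic_disc_def algebra_simps power2_eq_square power3_eq_cube)
  with False disc show ?thesis
    by (simp add: hessian_def sum_qchar_qform[OF two])
next
  case three: True
  have nine: "27 = (0::'a)" "9 = (0::'a)" "18 = (0::'a)"
    using arg_cong[OF three, of "\<lambda>t. 9 * t"] arg_cong[OF three, of "\<lambda>t. 3 * t"]
      arg_cong[OF three, of "\<lambda>t. 6 * t"] by simp_all
  have bc: "b \<noteq> 0 \<or> c \<noteq> 0" using disc by (auto simp: cubic_disc_def nine)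
  have "hessian a b c d s = (b * hx s - c * hy s)\<^sup>2" for s
  proof -
    have "hessian a b c d s = (b * hx s - c * hy s)\<^sup>2 + 3 * (b * c * hx s * hy s)"
      by (simp add: hessian_def qform_def three nine algebra_simps power2_eq_square)
    then show ?thesis by (simp add: three)
  qed
  then have h: "qchar (hessian a b c d s) = 1 - of_bool (b * hx s - c * hy s = 0)" for s
    by (simp add: qchar_simps)
  have "card {s. b * hx s - c * hy s = 0} = 1"
  proof (cases "b = 0")
    case True
    with bc show ?thesis by (simp add: card_Collect_option)
  next
    case False
    then have "{t. b * t = c} = {c / b}" by (auto simp: field_simps)
    with False show ?thesis by (simp add: card_Collect_option)
  qed
  then have "(\<Sum>s\<in>UNIV. of_bool (b * hx s - c * hy s = 0)) = (1::int)"
    by (simp add: of_bool_def sum.If_cases Collect_conj_eq)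
  moreover have "int CARD('a option) = int CARD('a) + 1" by simp
  ultimately show ?thesis using three by (simp add: h sum_subtractf)
qed

definition cayley_pairs :: "'a::field \<Rightarrow> 'a \<Rightarrow> 'a \<Rightarrow> 'a \<Rightarrow> ('a option \<times> 'a option) set" where
  "cayley_pairs a b c d =
     {(r, s). r \<noteq> s \<and> cubic a b c d s \<noteq> 0 \<and> cayley_form a b c d r s = 0}"

text \<open>
  The numbers of partners are summed over all \<open>s\<close>; at each of the \<open>k\<close> roots, which do not count as
  second entries, the formula for the number of partners would have given \<open>2\<close>, or \<open>1\<close> in
  characteristic \<open>3\<close>.
\<close>

lemma card_cayley_pairs:
  fixes a b c d :: "'a::{field,finite}"
  assumes two: "(2::'a) \<noteq> 0" and disc: "cubic_disc a b c d \<noteq> 0"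
  defines "k \<equiv> int (card {s. cubic a b c d s = 0})"
  shows "int (card (cayley_pairs a b c d)) =
    (if (3::'a) = 0 then int CARD('a) - k else int CARD('a) + 1 - 2 * k)"
proof -
  define Z where "Z = {s. cubic a b c d s = 0}"
  have "bij_betw prod.swap (cayley_pairs a b c d)
     (SIGMA s:UNIV - Z. {r. r \<noteq> s \<and> cayley_form a b c d r s = 0})"
    by (rule bij_betwI[of _ _ _ prod.swap]) (auto simp: cayley_pairs_def Z_def)
  then have "int (card (cayley_pairs a b c d)) =
      int (card (SIGMA s:UNIV - Z. {r. r \<noteq> s \<and> cayley_form a b c d r s = 0}))"
    by (simp add: bij_betw_same_card)
  also have "\<dots> = (\<Sum>s\<in>UNIV - Z. (if (3::'a) = 0 then 0 else 1) + qchar (hessian a b c d s))"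
    by (subst card_SigmaI) (auto simp: card_cayley_partners[OF two _ disc] Z_def)
  also have "\<dots> = (\<Sum>s\<in>UNIV. (if (3::'a) = 0 then 0 else 1) + qchar (hessian a b c d s)) -
      (\<Sum>s\<in>Z. (if (3::'a) = 0 then 0 else 1) + qchar (hessian a b c d s))"
    by (rule sum_diff) auto
  also have "(\<Sum>s\<in>Z. (if (3::'a) = 0 then 0 else 1) + qchar (hessian a b c d s)) =
      (if (3::'a) = 0 then 1 else 2) * k"
    by (simp add: Z_def qchar_hessian_at_root[OF _ disc] k_def)
  finally show ?thesis by (auto simp: sum.distrib sum_qchar_hessian[OF two disc])
qed

section \<open>Cayley's criterion in terms of mixed determinants\<close>

text \<open>
  The coefficient of \<open>t\<close> in \<open>det (A + t B)\<close>.
\<close>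

definition mixed_det :: "'a::comm_ring_1^3^3 \<Rightarrow> 'a^3^3 \<Rightarrow> 'a" where
  "mixed_det A B = (\<Sum>i\<in>UNIV. det (\<chi> j. if j = i then B $ j else A $ j))"

lemma mixed_det_3:
  "mixed_det (A::'a::comm_ring_1^3^3) B =
     det (vector [B $ 1, A $ 2, A $ 3]) + det (vector [A $ 1, B $ 2, A $ 3]) +
     det (vector [A $ 1, A $ 2, B $ 3])"
proof -
  have [simp]: "(2::3) \<noteq> 3" "(1::3) \<noteq> 3" "(1::3) \<noteq> 2" "(3::3) \<noteq> 1" "(2::3) \<noteq> 1" "(3::3) \<noteq> 2"
    by auto
  show ?thesis
    by (simp add: mixed_det_def sum_3 det_3 vector_3)
qed

lemma det_linear_combination:
  fixes A B :: "'a::comm_ring_1^3^3"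
  shows "det (\<chi> i j. x * A $ i $ j + y * B $ i $ j) =
    x ^ 3 * det A + x\<^sup>2 * y * mixed_det A B + x * y\<^sup>2 * mixed_det B A + y ^ 3 * det B"
  by (simp add: mixed_det_3 det_3 vector_3 algebra_simps power2_eq_square power3_eq_cube)

lemma det_over_closure: "det (over_closure M) = to_ac (det M)"
  by (simp add: over_closure_def det_3)

lemma mixed_det_over_closure:
  "mixed_det (over_closure A) (over_closure B) = to_ac (mixed_det A B)"
  by (simp add: over_closure_def mixed_det_3 det_3 vector_3)

lemma cayley_det_nth:
  "cayley_det A B $ 0 = det B" "cayley_det A B $ 1 = mixed_det B A"
  "cayley_det A B $ 2 = mixed_det A B"
proof -
  define A' B' :: "'a fps^3^3" where "A' = (\<chi> i j. fps_const (A $ i $ j))" and "B' = (\<chi> i j. fps_const (B $ i $ j))"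
  have "cayley_det A B = fps_X ^ 3 * det A' + fps_X\<^sup>2 * mixed_det A' B' + fps_X * mixed_det B' A' + det B'"
    using det_linear_combination[of fps_X A' 1 B'] by (simp add: cayley_det_def A'_def B'_def)
  also have "det A' = fps_const (det A)" by (simp add: A'_def det_3)
  also have "det B' = fps_const (det B)" by (simp add: B'_def det_3)
  also have "mixed_det A' B' = fps_const (mixed_det A B)" by (simp add: A'_def B'_def det_3 mixed_det_3 vector_3)
  also have "mixed_det B' A' = fps_const (mixed_det B A)" by (simp add: A'_def B'_def det_3 mixed_det_3 vector_3)
  finally have eq: "cayley_det A B = fps_X ^ 3 * fps_const (det A) + fps_X\<^sup>2 * fps_const (mixed_det A B) +
    fps_X * fps_const (mixed_det B A) + fps_const (det B)" .
  show "cayley_det A B $ 0 = det B" "cayley_det A B $ 1 = mixed_det B A"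
  "cayley_det A B $ 2 = mixed_det A B"
    by (simp_all add: eq fps_X_power_mult_nth fps_X_mult_nth)
qed

lemma fps_square_nth:
  fixes H :: "'a::comm_ring_1 fps"
  shows "(H\<^sup>2) $ 0 = (H $ 0)\<^sup>2" "(H\<^sup>2) $ 1 = 2 * H $ 0 * H $ 1"
    "(H\<^sup>2) $ 2 = 2 * H $ 0 * H $ 2 + (H $ 1)\<^sup>2"
  by (simp_all add: power2_eq_square fps_mult_nth numeral_2_eq_2 algebra_simps)

text \<open>
  Comparing coefficients in \<open>H\<^sup>2 = F\<close> determines \<open>H\<close> recursively from \<open>h = H\<^sub>0\<close>, with divisions by
  \<open>2 h\<close> only, so that the characteristic may be any other than \<open>2\<close>.
\<close>

function sqrt_coeff :: "'a::field \<Rightarrow> 'a fps \<Rightarrow> nat \<Rightarrow> 'a" where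
  "sqrt_coeff h F n = (if n = 0 then h else
     (F $ n - (\<Sum>i\<in>{1..<n}. sqrt_coeff h F i * sqrt_coeff h F (n - i))) / (2 * h))"
  by auto
termination by (relation "Wellfounded.measure (\<lambda>(h, F, n). n)") auto

declare sqrt_coeff.simps [simp del]

lemma fps_sqrt_exists:
  fixes F :: "'a::alg_closed_field fps"
  assumes "(2::'a) \<noteq> 0" "F $ 0 \<noteq> 0"
  shows "\<exists>H. H\<^sup>2 = F"
proof -
  obtain h where h: "h\<^sup>2 = F $ 0" using nth_root_exists[of 2 "F $ 0"] by auto
  with assms have h0: "h \<noteq> 0" by auto
  define H where "H = Abs_fps (sqrt_coeff h F)"
  have "(H\<^sup>2) $ n = F $ n" for n
  proof (cases "n = 0")
    case True
    then show ?thesis by (simp add: fps_square_nth H_def h sqrt_coeff.simps)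
  next
    case False
    then have split: "{0..n} = insert 0 (insert n {1..<n})" by auto
    have "(H\<^sup>2) $ n = (\<Sum>i=0..n. sqrt_coeff h F i * sqrt_coeff h F (n - i))"
      by (simp add: power2_eq_square fps_mult_nth H_def)
    also have "\<dots> = 2 * h * sqrt_coeff h F n +
        (\<Sum>i\<in>{1..<n}. sqrt_coeff h F i * sqrt_coeff h F (n - i))"
      unfolding split using False by (simp add: sqrt_coeff.simps[of _ _ 0])
    also have "2 * h * sqrt_coeff h F n =
        F $ n - (\<Sum>i\<in>{1..<n}. sqrt_coeff h F i * sqrt_coeff h F (n - i))"
      using False h0 assms(1) by (subst sqrt_coeff.simps) simp
    finally show ?thesis by simp
  qed
  then show ?thesis by (auto simp: fps_eq_iff)
qed

text \<open>
  With \<open>det (t A + B) = f\<^sub>0 + f\<^sub>1 t + f\<^sub>2 t\<^sup>2 + \<dots>\<close> and \<open>H\<^sup>2\<close> equal to it, \<open>f\<^sub>1\<^sup>2 - 4 f\<^sub>0 f\<^sub>2 = -8 H\<^sub>0\<^sup>3 H\<^sub>2\<close>.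
\<close>

lemma poncelet3_iff:
  fixes A B :: "'a::field^3^3"
  assumes two: "(2::'a) \<noteq> 0" and B: "det B \<noteq> 0"
  shows "poncelet3 A B \<longleftrightarrow> (mixed_det B A)\<^sup>2 - 4 * det B * mixed_det A B = 0"
proof -
  let ?F = "cayley_det (over_closure A) (over_closure B)"
  have two': "(2::'a alg_closure) \<noteq> 0"
    using two by (metis to_ac_eq_0_iff to_ac_numeral)
  have F: "?F $ 0 = to_ac (det B)" "?F $ 1 = to_ac (mixed_det B A)" "?F $ 2 = to_ac (mixed_det A B)"
    by (simp_all add: cayley_det_nth det_over_closure mixed_det_over_closure del: One_nat_def)
  have key: "fps_nth H 2 = 0 \<longleftrightarrow> (mixed_det B A)\<^sup>2 - 4 * det B * mixed_det A B = 0" if H: "H\<^sup>2 = ?F" for H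
  proof -
    define h0 h1 h2 where "h0 = H $ 0" "h1 = H $ 1" "h2 = H $ 2"
    have e: "h0\<^sup>2 = to_ac (det B)" "2 * h0 * h1 = to_ac (mixed_det B A)"
      "2 * h0 * h2 + h1\<^sup>2 = to_ac (mixed_det A B)"
      using F fps_square_nth[of H] by (simp_all add: H h0_h1_h2_def)
    have "to_ac ((mixed_det B A)\<^sup>2 - 4 * det B * mixed_det A B) = - (8 * h0 ^ 3 * h2)"
      by (simp add: e[symmetric] algebra_simps power2_eq_square power3_eq_cube)
    moreover have "h0 \<noteq> 0" using e(1) B by auto
    moreover have "(8::'a alg_closure) = 2 ^ 3" by simp
    then have "(8::'a alg_closure) \<noteq> 0" using two' by (metis power_not_zero)
    ultimately have "to_ac ((mixed_det B A)\<^sup>2 - 4 * det B * mixed_det A B) = 0 \<longleftrightarrow> h2 = 0"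
      by (simp del: to_ac_diff to_ac_eq_0_iff)
    then show ?thesis unfolding to_ac_eq_0_iff by (simp add: h0_h1_h2_def)
  qed
  obtain H where "H\<^sup>2 = ?F"
    using fps_sqrt_exists[OF two', of ?F] B F(1) by auto
  with key show ?thesis unfolding poncelet3_def by blast
qed

text \<open>
  The determinant of the member with parameter \<open>(x : y)\<close> is \<open>a x\<^sup>3 + b x\<^sup>2 y + c x y\<^sup>2 + d y\<^sup>3\<close>.
\<close>

definition pencil_cubic :: "'a::field pencil \<Rightarrow> 'a \<Rightarrow> 'a \<Rightarrow> 'a \<Rightarrow> 'a \<Rightarrow> bool" where
  "pencil_cubic P a b c d \<longleftrightarrow> det (fst P) = a \<and> mixed_det (fst P) (snd P) = b \<and>
     mixed_det (snd P) (fst P) = c \<and> det (snd P) = d"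

lemma member_eq: "member P r = (\<chi> i j. hx r * fst P $ i $ j + hy r * snd P $ i $ j)"
  by (cases P; cases r) (simp_all add: vec_eq_iff)

lemma det_member: "pencil_cubic P a b c d \<Longrightarrow> det (member P r) = cubic a b c d r"
  by (auto simp: pencil_cubic_def member_eq det_linear_combination cubic_def)

lemma smooth_member: "pencil_cubic P a b c d \<Longrightarrow> smooth_conic (member P r) \<longleftrightarrow> cubic a b c d r \<noteq> 0"
  by (simp add: smooth_conic_def invertible_det_nz det_member)

lemma mixed_det_member: "pencil_cubic P a b c d \<Longrightarrow> mixed_det (member P s) (member P r) = polar a b c d s r"
proof -
  assume "pencil_cubic P a b c d"
  then have eqs: "a = det (fst P)" "b = mixed_det (fst P) (snd P)"
      "c = mixed_det (snd P) (fst P)" "d = det (snd P)"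
    by (simp_all add: pencil_cubic_def)
  show ?thesis
    by (cases r; cases s; simp add: eqs member_eq mixed_det_3 det_3 vector_3 polar_def
        algebra_simps power2_eq_square)
qed

lemma poncelet3_member:
  assumes "(2::'a::field) \<noteq> 0" "pencil_cubic (P::'a pencil) a b c d" "cubic a b c d s \<noteq> 0"
  shows "poncelet3 (member P r) (member P s) \<longleftrightarrow> cayley_form a b c d r s = 0"
  using assms by (simp add: poncelet3_iff det_member mixed_det_member cayley_form_def)

section \<open>Probabilities\<close>

definition pairs_from :: "'b set \<Rightarrow> 'b set \<Rightarrow> ('b \<times> 'b) set" where
  "pairs_from R S = {(r, s). r \<noteq> s \<and> r \<in> R \<and> s \<in> S}"

lemma card_pairs_from:
  assumes "finite R" "S \<subseteq> R"
  shows "real (card (pairs_from R S)) = real (card S) * (real (card R) - 1)"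
proof -
  have fin: "finite S" using assms finite_subset by blast
  have "bij_betw prod.swap (pairs_from R S) (SIGMA s:S. R - {s})"
    by (rule bij_betwI[of _ _ _ prod.swap]) (auto simp: pairs_from_def)
  then have "real (card (pairs_from R S)) = real (card (SIGMA s:S. R - {s}))"
    by (simp add: bij_betw_same_card)
  also have "\<dots> = (\<Sum>s\<in>S. real (card (R - {s})))"
    using assms fin by (subst card_SigmaI) auto
  also have "\<dots> = (\<Sum>s\<in>S. real (card R) - 1)"
  proof (rule sum.cong)
    fix s assume "s \<in> S"
    with assms have s: "s \<in> R" by auto
    with assms have "card R \<ge> 1" by (metis One_nat_def Suc_leI card_gt_0_iff empty_iff)
    with s show "real (card (R - {s})) = real (card R) - 1"
      by (simp add: card_Diff_singleton of_nat_diff)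
  qed simp
  finally show ?thesis by simp
qed

lemma prob_pmf_of_set:
  "finite S \<Longrightarrow> S \<noteq> {} \<Longrightarrow> measure_pmf.prob (pmf_of_set S) E = card (S \<inter> E) / card S"
  by (simp add: measure_pmf_of_set)

text \<open>\<open>G\<close> is the set of the parameters of those singular members that occur in valid pairs.\<close>

definition good_singular :: "'a::field pencil \<Rightarrow> 'a option set \<Rightarrow> bool" where
  "good_singular P G \<longleftrightarrow> (\<forall>r\<in>G. \<not> smooth_conic (member P r)) \<and>
    (\<forall>r s. \<not> smooth_conic (member P r) \<longrightarrow> smooth_conic (member P s) \<longrightarrow>
      (valid_conics (member P r) (member P s) \<longleftrightarrow> r \<in> G))"

lemma smooth_pairs_eq:
  assumes "pencil_cubic P a b c d"
  shows "smooth_pairs P = pairs_from {r. cubic a b c d r \<noteq> 0} {r. cubic a b c d r \<noteq> 0}"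
  by (auto simp: smooth_pairs_def pairs_from_def smooth_member[OF assms])

lemma valid_pairs_eq:
  assumes P: "pencil_cubic P a b c d" and G: "good_singular P G"
  shows "valid_pairs P = pairs_from ({r. cubic a b c d r \<noteq> 0} \<union> G) {r. cubic a b c d r \<noteq> 0}"
proof -
  have "valid_conics (member P r) (member P s) \<longleftrightarrow>
      smooth_conic (member P s) \<and> (smooth_conic (member P r) \<or> r \<in> G)" for r s
    using G unfolding good_singular_def valid_conics_def by blast
  then show ?thesis
    by (auto simp: valid_pairs_def pairs_from_def smooth_member[OF P])
qed

lemma prob_poncelet_pairs_from:
  fixes P :: "'a::{field,finite} pencil"
  assumes two: "(2::'a) \<noteq> 0" and P: "pencil_cubic P a b c d"
    and S: "S = {r. cubic a b c d r \<noteq> 0}" and R: "S \<subseteq> R"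
    and ne: "S \<noteq> {}" "card R \<ge> 2"
  shows "measure_pmf.prob (pmf_of_set (pairs_from R S)) {(r, s). poncelet3 (member P r) (member P s)} =
    real (card (pairs_from R S \<inter> {(r, s). cayley_form a b c d r s = 0})) /
      (real (card S) * (real (card R) - 1))"
proof -
  have eq: "pairs_from R S \<inter> {(r, s). poncelet3 (member P r) (member P s)} =
      pairs_from R S \<inter> {(r, s). cayley_form a b c d r s = 0}"
    by (auto simp: pairs_from_def S poncelet3_member[OF two P])
  have "real (card S) * (real (card R) - 1) \<noteq> 0" using ne by (simp add: card_gt_0_iff)
  then have "pairs_from R S \<noteq> {}"
    using card_pairs_from[OF _ R] by (metis card.empty finite of_nat_0)
  then show ?thesis
    using card_pairs_from[OF _ R] by (simp add: prob_pmf_of_set eq)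
qed

lemma card_complement_option:
  fixes A :: "'a::finite option set"
  shows "int (card (- A)) = int CARD('a) + 1 - int (card A)"
proof -
  have "card A \<le> CARD('a option)" by (rule card_mono) auto
  then show ?thesis by (simp add: Compl_eq_Diff_UNIV card_Diff_subset of_nat_diff)
qed

text \<open>
  Here all \<open>k\<close> singular members are admissible, so that there are \<open>(q + 1 - k) (q - k)\<close> smooth pairs and
  \<open>(q + 1 - k) q\<close> valid ones; by \<open>cayley_form_at_root\<close> the Poncelet pairs are the same in both cases.
  The bounds on \<open>q + 1 - k\<close> say that there are pairs at all.
\<close>

lemma squarefree_pencil:
  fixes P :: "'a::{field,finite} pencil"
  assumes two: "(2::'a) \<noteq> 0" and P: "pencil_cubic P a b c d" and disc: "cubic_disc a b c d \<noteq> 0"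
    and good: "good_singular P {r. cubic a b c d r = 0}"
    and k: "card {r. cubic a b c d r = 0} = k"
    and q: "q = real CARD('a)"
  defines "N \<equiv> (if (3::'a) = 0 then q - k else q + 1 - 2 * k)"
  shows "q + 1 - k \<ge> 2 \<Longrightarrow> p_smooth P = N / ((q + 1 - k) * (q - k))"
    and "q + 1 - k \<ge> 1 \<Longrightarrow> p_valid P = N / ((q + 1 - k) * q)"
proof -
  let ?S = "{r. cubic a b c d r \<noteq> 0}"
  have "int (card ?S) = int CARD('a) + 1 - int k"
    using card_complement_option[of "{r. cubic a b c d r = 0}"] by (simp add: Collect_neg_eq k)
  then have cardS: "real (card ?S) = q + 1 - real k"
    unfolding q by linarith
  have "int (card (cayley_pairs a b c d)) =
     (if (3::'a) = 0 then int CARD('a) - k else int CARD('a) + 1 - 2 * k)"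
    using card_cayley_pairs[OF two disc] k by simp
  then have "real_of_int (int (card (cayley_pairs a b c d))) =
     real_of_int (if (3::'a) = 0 then int CARD('a) - k else int CARD('a) + 1 - 2 * k)"
    by (simp only:)
  then have N: "real (card (cayley_pairs a b c d)) = N"
    unfolding N_def q by simp
  have I: "pairs_from R ?S \<inter> {(r, s). cayley_form a b c d r s = 0} = cayley_pairs a b c d"
    if "?S \<subseteq> R" for R
    using that cayley_form_at_root[OF _ _ disc]
    by (auto simp: pairs_from_def cayley_pairs_def)
  have q2: "q \<ge> 2" using card_odd_field(1)[OF two] unfolding q by simp
  show "p_smooth P = N / ((q + 1 - k) * (q - k))" if "q + 1 - k \<ge> 2"
  proof -
    have "card ?S \<ge> 2" using that cardS by linarith
    moreover from this have "?S \<noteq> {}" by (metis card.empty not_numeral_le_zero)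
    ultimately show ?thesis
      unfolding p_smooth_def smooth_pairs_eq[OF P]
      by (subst prob_poncelet_pairs_from[OF two P refl]) (auto simp: I N cardS)
  qed
  show "p_valid P = N / ((q + 1 - k) * q)" if "q + 1 - k \<ge> 1"
  proof -
    have "card ?S \<ge> 1" using that cardS by linarith
    then have ne: "?S \<noteq> {}" by (metis card.empty not_one_le_zero)
    have U: "?S \<union> {r. cubic a b c d r = 0} = UNIV" by auto
    have "CARD('a option) \<ge> 2" using q2 q by simp
    then show ?thesis
      unfolding p_valid_def valid_pairs_eq[OF P good] U
      by (subst prob_poncelet_pairs_from[OF two P refl])
        (use ne in \<open>auto simp: I N cardS q\<close>)
  qed
qed

lemma nonzero_parameters:
  fixes a :: "'a::{field,finite}"
  shows "card (Some ` (UNIV - {0::'a})) = CARD('a) - 1"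
  by (simp add: card_image card_Diff_singleton)

text \<open>
  The cubic has its roots at \<open>0\<close> and \<open>\<infinity>\<close>, one of them double. Cayley's condition then is
  \<open>r = \<kappa> s\<close> for a constant \<open>\<kappa>\<close>, which respects \<open>r \<noteq> s\<close> except in characteristic \<open>3\<close>. An
  admissible singular member enlarges the number of pairs without contributing Poncelet pairs.
\<close>

lemma two_root_pencil:
  fixes P :: "'a::{field,finite} pencil"
  assumes two: "(2::'a) \<noteq> 0" and P: "pencil_cubic P a b c d"
    and S: "{r. cubic a b c d r \<noteq> 0} = Some ` (UNIV - {0})"
    and good: "good_singular P G" and G: "G \<subseteq> {Some 0}"
    and cay: "\<And>x y. y \<noteq> 0 \<Longrightarrow> x \<noteq> 0 \<or> Some 0 \<in> G \<Longrightarrow>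
         cayley_form a b c d (Some x) (Some y) = 0 \<longleftrightarrow> x = \<kappa> * y"
    and \<kappa>: "\<kappa> \<noteq> 0" "\<kappa> = 1 \<longleftrightarrow> (3::'a) = 0"
    and q: "q = real CARD('a)"
  shows "p_smooth P = (if (3::'a) = 0 then 0 else 1 / (q - 2))"
    and "p_valid P = (if (3::'a) = 0 then 0 else 1 / (q - 2 + card G))"
proof -
  let ?S = "Some ` (UNIV - {0::'a})"
  note q3 = card_odd_field(1)[OF two]
  have cardS: "real (card ?S) = q - 1" using q3 by (simp add: nonzero_parameters q of_nat_diff)
  have cardU: "real (card (?S \<union> H)) = q - 1 + card H" if "H \<subseteq> {Some 0}" for H
  proof -
    have "card (?S \<union> H) = card ?S + card H"
      by (rule card_Un_disjoint) (use that in auto)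
    with cardS show ?thesis by simp
  qed
  have count: "real (card (pairs_from (?S \<union> H) ?S \<inter> {(r, s). cayley_form a b c d r s = 0})) =
      (if (3::'a) = 0 then 0 else q - 1)" if H: "H \<subseteq> G" for H
  proof (cases "(3::'a) = 0")
    case True
    have "pairs_from (?S \<union> H) ?S \<inter> {(r, s). cayley_form a b c d r s = 0} = {}"
      using H G cay \<kappa> True by (auto simp: pairs_from_def)
    with True show ?thesis by simp
  next
    case False
    have H0: "r = Some 0 \<and> Some 0 \<in> G" if "r \<in> H" for r
      using that H G by blast
    have "pairs_from (?S \<union> H) ?S \<inter> {(r, s). cayley_form a b c d r s = 0} =
        (\<lambda>y. (Some (\<kappa> * y), Some y)) ` (UNIV - {0})"
      using cay \<kappa> False by (auto simp: pairs_from_def image_iff dest!: H0)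
    also have "real (card \<dots>) = q - 1"
      using cardS by (simp add: card_image inj_on_def)
    finally show ?thesis using False by simp
  qed
  have c2: "card (?S \<union> H) \<ge> 2" if "H \<subseteq> G" for H
  proof -
    have "card ?S \<le> card (?S \<union> H)" by (rule card_mono) auto
    with cardS q3 q show ?thesis by linarith
  qed
  have ne: "?S \<noteq> {}" using two by auto
  have main: "measure_pmf.prob (pmf_of_set (pairs_from (?S \<union> H) ?S))
       {(r, s). poncelet3 (member P r) (member P s)} =
     (if (3::'a) = 0 then 0 else 1 / (q - 2 + card H))" if H: "H \<subseteq> G" for H
  proof -
    have "H \<subseteq> {Some 0}" using H G by blast
    then have "measure_pmf.prob (pmf_of_set (pairs_from (?S \<union> H) ?S))
       {(r, s). poncelet3 (member P r) (member P s)} =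
      (if (3::'a) = 0 then 0 else q - 1) / ((q - 1) * (q - 1 + card H - 1))"
      by (subst prob_poncelet_pairs_from[OF two P S[symmetric] _ ne c2[OF H]])
         (simp_all only: count[OF H] cardS cardU Un_upper1)
    moreover have "q - 1 \<noteq> 0" using q3 q by simp
    ultimately show ?thesis by (simp add: diff_diff_eq)
  qed
  show "p_smooth P = (if (3::'a) = 0 then 0 else 1 / (q - 2))"
    using main[of "{}"] by (simp add: p_smooth_def smooth_pairs_eq[OF P] S)
  show "p_valid P = (if (3::'a) = 0 then 0 else 1 / (q - 2 + card G))"
    using main[of G] by (simp add: p_valid_def valid_pairs_eq[OF P good] S)
qed

lemma cayley_form_double_root:
  fixes b :: "'a::field"
  assumes two: "(2::'a) \<noteq> 0" and b: "b \<noteq> 0"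
  shows "y \<noteq> 0 \<Longrightarrow> cayley_form 0 b 0 0 (Some x) (Some y) = 0 \<longleftrightarrow> x = 1 / 4 * y"
    and "x \<noteq> 0 \<Longrightarrow> cayley_form 0 0 b 0 (Some x) (Some y) = 0 \<longleftrightarrow> x = 4 * y"
proof -
  have "cayley_form 0 b 0 0 (Some x) (Some y) = b\<^sup>2 * y ^ 3 * (y - 4 * x)"
    by (simp add: cayley_form_def cubic_def polar_def algebra_simps power2_eq_square power3_eq_cube)
  then show "y \<noteq> 0 \<Longrightarrow> cayley_form 0 b 0 0 (Some x) (Some y) = 0 \<longleftrightarrow> x = 1 / 4 * y"
    using b two_powers_neq_0(1)[OF two] by (auto simp: field_simps)
  have "cayley_form 0 0 b 0 (Some x) (Some y) = b\<^sup>2 * x * (x - 4 * y)"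
    by (simp add: cayley_form_def cubic_def polar_def algebra_simps power2_eq_square power3_eq_cube)
  then show "x \<noteq> 0 \<Longrightarrow> cayley_form 0 0 b 0 (Some x) (Some y) = 0 \<longleftrightarrow> x = 4 * y"
    using b by auto
qed

lemma four_eq_1_iff: "(4::'a::field) = 1 \<longleftrightarrow> (3::'a) = 0"
proof -
  have "(4::'a) - 1 = 3" by simp
  then show ?thesis by (metis right_minus_eq)
qed

lemma double_root_pencil:
  fixes P :: "'a::{field,finite} pencil"
  assumes two: "(2::'a) \<noteq> 0" and P: "pencil_cubic P 0 b 0 0" and b: "b \<noteq> 0"
    and good: "good_singular P G" and G: "G \<subseteq> {Some 0}"
    and q: "q = real CARD('a)"
  shows "p_smooth P = (if (3::'a) = 0 then 0 else 1 / (q - 2))"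
    and "p_valid P = (if (3::'a) = 0 then 0 else 1 / (q - 2 + card G))"
proof -
  have S: "{r. cubic 0 b 0 0 r \<noteq> 0} = Some ` (UNIV - {0})"
  proof (rule Set.set_eqI)
    fix r show "r \<in> {r. cubic 0 b 0 0 r \<noteq> 0} \<longleftrightarrow> r \<in> Some ` (UNIV - {0})"
      using b by (cases r) (auto simp: cubic_def)
  qed
  have k: "(1 / 4 :: 'a) \<noteq> 0" "(1 / 4 :: 'a) = 1 \<longleftrightarrow> (3::'a) = 0"
    using two_powers_neq_0(1)[OF two] four_eq_1_iff[where 'a = 'a] by (auto simp: field_simps)
  show "p_smooth P = (if (3::'a) = 0 then 0 else 1 / (q - 2))"
    and "p_valid P = (if (3::'a) = 0 then 0 else 1 / (q - 2 + card G))"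
    using two_root_pencil[OF two P S good G cayley_form_double_root(1)[OF two b] k q] by simp_all
qed

lemma double_root_at_infinity_pencil:
  fixes P :: "'a::{field,finite} pencil"
  assumes two: "(2::'a) \<noteq> 0" and P: "pencil_cubic P 0 0 c 0" and c: "c \<noteq> 0"
    and good: "good_singular P {}"
    and q: "q = real CARD('a)"
  shows "p_smooth P = (if (3::'a) = 0 then 0 else 1 / (q - 2))"
    and "p_valid P = (if (3::'a) = 0 then 0 else 1 / (q - 2))"
proof -
  have S: "{r. cubic 0 0 c 0 r \<noteq> 0} = Some ` (UNIV - {0})"
  proof (rule Set.set_eqI)
    fix r show "r \<in> {r. cubic 0 0 c 0 r \<noteq> 0} \<longleftrightarrow> r \<in> Some ` (UNIV - {0})"
      using c by (cases r) (auto simp: cubic_def)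
  qed
  have cay: "x \<noteq> 0 \<or> Some 0 \<in> ({}::'a option set) \<Longrightarrow>
      cayley_form 0 0 c 0 (Some x) (Some y) = 0 \<longleftrightarrow> x = 4 * y" for x y
    using cayley_form_double_root(2)[OF two c, of x y] by simp
  show "p_smooth P = (if (3::'a) = 0 then 0 else 1 / (q - 2))"
    and "p_valid P = (if (3::'a) = 0 then 0 else 1 / (q - 2))"
    using two_root_pencil[OF two P S good _ cay two_powers_neq_0(1)[OF two] four_eq_1_iff q] by simp_all
qed

lemma triple_root_pencil:
  fixes P :: "'a::{field,finite} pencil"
  assumes two: "(2::'a) \<noteq> 0" and P: "pencil_cubic P 0 0 0 d" and d: "d \<noteq> 0"
    and good: "good_singular P {}"
  shows "p_smooth P = of_bool ((3::'a) = 0)" "p_valid P = of_bool ((3::'a) = 0)"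
proof -
  let ?S = "range (Some :: 'a \<Rightarrow> _)"
  have S: "{r. cubic 0 0 0 d r \<noteq> 0} = ?S"
  proof (rule Set.set_eqI)
    fix r show "r \<in> {r. cubic 0 0 0 d r \<noteq> 0} \<longleftrightarrow> r \<in> ?S"
      using d by (cases r) (auto simp: cubic_def)
  qed
  have cS: "card ?S = CARD('a)" by (simp add: card_image)
  have c2: "card ?S \<ge> 2" using card_odd_field(1)[OF two] unfolding cS by simp
  have "cayley_form 0 0 0 d (Some x) (Some y) = - 3 * d\<^sup>2" for x y
    by (simp add: cayley_form_def cubic_def polar_def algebra_simps power2_eq_square)
  with d have "pairs_from ?S ?S \<inter> {(r, s). cayley_form 0 0 0 d r s = 0} =
      (if (3::'a) = 0 then pairs_from ?S ?S else {})"
    by (auto simp: pairs_from_def)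
  then have "measure_pmf.prob (pmf_of_set (pairs_from ?S ?S))
       {(r, s). poncelet3 (member P r) (member P s)} = of_bool ((3::'a) = 0)"
    using c2
    by (subst prob_poncelet_pairs_from[OF two P S[symmetric]]) (auto simp: card_pairs_from)
  then show "p_smooth P = of_bool ((3::'a) = 0)" "p_valid P = of_bool ((3::'a) = 0)"
    by (simp_all add: p_smooth_def p_valid_def smooth_pairs_eq[OF P] valid_pairs_eq[OF P good] S)
qed

(* From here on, $ denotes only the components of vectors; a second reading would be tried at each
   occurrence. *)
no_notation fps_nth (infixl "$" 75)

section \<open>Tangency and valid pairs\<close>

text \<open>
  Four times the quadratic form of the adjugate matrix of the conic.
\<close>

definition dual_form :: "'a::field \<Rightarrow> 'a \<Rightarrow> 'a \<Rightarrow> 'a \<Rightarrow> 'a \<Rightarrow> 'a \<Rightarrow> 'a \<Rightarrow> 'a \<Rightarrow> 'a \<Rightarrow> 'a" where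
  "dual_form a b c h g f l1 l2 l3 =
     (4 * b * c - f\<^sup>2) * l1\<^sup>2 + (4 * a * c - g\<^sup>2) * l2\<^sup>2 + (4 * a * b - h\<^sup>2) * l3\<^sup>2 +
     2 * (g * f - 2 * c * h) * l1 * l2 + 2 * (h * f - 2 * b * g) * l1 * l3 +
     2 * (h * g - 2 * a * f) * l2 * l3"

lemma vector_3_eta: "(v::'a::zero^3) = vector [v $ 1, v $ 2, v $ 3]"
  by (simp add: vec_eq_iff forall_3 vector_3)

lemma quad_form_conic:
  assumes "(2::'a::field) \<noteq> 0"
  shows "quad_form (conic_matrix a b c h g f) (v::'a^3) =
    a * (v $ 1)\<^sup>2 + b * (v $ 2)\<^sup>2 + c * (v $ 3)\<^sup>2 + h * (v $ 1 * v $ 2) + g * (v $ 1 * v $ 3) +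
    f * (v $ 2 * v $ 3)"
  by (subst vector_3_eta) (rule quad_form_conic_matrix[OF assms])

lemma over_closure_conic_matrix:
  "over_closure (conic_matrix a b c h g f) =
    conic_matrix (to_ac a) (to_ac b) (to_ac c) (to_ac h) (to_ac g) (to_ac f)"
  by (simp add: over_closure_def conic_matrix_def vec_eq_iff forall_3 vector_3)

lemma det_conic_matrix:
  assumes two: "(2::'a::field) \<noteq> 0"
  shows "4 * det (conic_matrix a b c h g f :: 'a^3^3) =
    4 * a * b * c + h * g * f - a * f\<^sup>2 - b * g\<^sup>2 - c * h\<^sup>2"
proof -
  define h' g' f' where "h' = h / 2" "g' = g / 2" "f' = f / 2"
  with two have "h = 2 * h'" "g = 2 * g'" "f = 2 * f'" by (simp_all add: mult.commute)
  with two show ?thesis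
    by (simp add: conic_matrix_def det_3 vector_3 algebra_simps power2_eq_square)
qed

text \<open>
  With \<open>N\<close> the adjugate matrix of \<open>M\<close>, a tangent line \<open>l = t M p\<close> satisfies
  \<open>l\<^sup>T N l = t\<^sup>2 det M p\<^sup>T M p = 0\<close>. Conversely, \<open>N l\<close> is the pole of \<open>l\<close>, and it lies on the conic
  when \<open>l\<^sup>T N l = 0\<close>.
\<close>

lemma tangent_line_iff:
  assumes two: "(2::'a::field) \<noteq> 0" and det: "det (conic_matrix a b c h g f :: 'a^3^3) \<noteq> 0"
    and l: "l \<noteq> 0"
  shows "tangent_line (conic_matrix a b c h g f) l \<longleftrightarrow> dual_form a b c h g f (l $ 1) (l $ 2) (l $ 3) = 0"
proof -
  define h' g' f' where hgf: "h' = h / 2" "g' = g / 2" "f' = f / 2"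
  define M where "M = conic_matrix a b c h g f"
  define k where "k = a * b * c + 2 * h' * g' * f' - a * f'\<^sup>2 - b * g'\<^sup>2 - c * h'\<^sup>2"
  from two hgf have half: "h = 2 * h'" "g = 2 * g'" "f = 2 * f'" by (simp_all add: mult.commute)
  have Mv: "(M *v p) $ 1 = a * p $ 1 + h' * p $ 2 + g' * p $ 3"
    "(M *v p) $ 2 = h' * p $ 1 + b * p $ 2 + f' * p $ 3"
    "(M *v p) $ 3 = g' * p $ 1 + f' * p $ 2 + c * p $ 3" for p
    using two by (simp_all add: M_def half conic_matrix_def matrix_vector_mult_def sum_3 vector_3)
  have "4 * det M = 4 * k"
    unfolding M_def det_conic_matrix[OF two] by (simp add: half k_def algebra_simps power2_eq_square)
  with det have k: "k \<noteq> 0" using two_powers_neq_0(1)[OF two] by (simp add: M_def)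
  have Q: "quad_form M p = a * (p $ 1)\<^sup>2 + b * (p $ 2)\<^sup>2 + c * (p $ 3)\<^sup>2 + 2 * h' * (p $ 1 * p $ 2) +
      2 * g' * (p $ 1 * p $ 3) + 2 * f' * (p $ 2 * p $ 3)" for p
    unfolding M_def quad_form_conic[OF two] by (simp add: half)
  show ?thesis unfolding M_def[symmetric]
  proof
    assume "tangent_line M l"
    then obtain p t where p: "quad_form M p = 0" and l: "l = t *s (M *v p)"
      unfolding tangent_line_def by blast
    have "dual_form a b c h g f (l $ 1) (l $ 2) (l $ 3) = 4 * t\<^sup>2 * k * quad_form M p"
      unfolding Q l dual_form_def by (simp add: Mv half k_def algebra_simps power2_eq_square)
    with p show "dual_form a b c h g f (l $ 1) (l $ 2) (l $ 3) = 0" by simp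
  next
    assume D: "dual_form a b c h g f (l $ 1) (l $ 2) (l $ 3) = 0"
    define p :: "'a^3" where "p = vector [
      (b * c - f'\<^sup>2) * l $ 1 + (g' * f' - c * h') * l $ 2 + (h' * f' - b * g') * l $ 3,
      (g' * f' - c * h') * l $ 1 + (a * c - g'\<^sup>2) * l $ 2 + (h' * g' - a * f') * l $ 3,
      (h' * f' - b * g') * l $ 1 + (h' * g' - a * f') * l $ 2 + (a * b - h'\<^sup>2) * l $ 3]"
    have Mp: "M *v p = k *s l"
      by (simp add: vec_eq_iff forall_3 Mv p_def vector_3 k_def algebra_simps power2_eq_square)
    have "4 * quad_form M p = k * dual_form a b c h g f (l $ 1) (l $ 2) (l $ 3)"
      unfolding Q dual_form_def
      by (simp add: p_def vector_3 half k_def algebra_simps power2_eq_square)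
    with D two_powers_neq_0(1)[OF two] have "quad_form M p = 0" by simp
    moreover have "p \<noteq> 0" using Mp k l by auto
    moreover have "l = (1 / k) *s (M *v p)" using k by (simp add: Mp)
    ultimately show "tangent_line M l"
      unfolding tangent_line_def using k by (intro exI[of _ p] exI[of _ "1 / k"]) simp
  qed
qed

text \<open>
  Comparison of coefficients in the factorization of a quadratic form into the linear forms \<open>l\<close> and
  \<open>m\<close>; the nonvanishing of some minor means that the two lines are distinct.
\<close>

definition line_pair ::
  "'a::field \<Rightarrow> 'a \<Rightarrow> 'a \<Rightarrow> 'a \<Rightarrow> 'a \<Rightarrow> 'a \<Rightarrow> 'a \<Rightarrow> 'a \<Rightarrow> 'a \<Rightarrow> 'a \<Rightarrow> 'a \<Rightarrow> 'a \<Rightarrow> bool" where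
  "line_pair a b c h g f l1 l2 l3 m1 m2 m3 \<longleftrightarrow>
     a = l1 * m1 \<and> b = l2 * m2 \<and> c = l3 * m3 \<and>
     h = l1 * m2 + l2 * m1 \<and> g = l1 * m3 + l3 * m1 \<and> f = l2 * m3 + l3 * m2 \<and>
     (l1 * m2 \<noteq> l2 * m1 \<or> l1 * m3 \<noteq> l3 * m1 \<or> l2 * m3 \<noteq> l3 * m2)"

lemma union_of_distinct_lines_iff:
  assumes two: "(2::'a::field) \<noteq> 0"
  shows "union_of_distinct_lines (conic_matrix a b c h g f) l (m::'a^3) \<longleftrightarrow>
    line_pair a b c h g f (l $ 1) (l $ 2) (l $ 3) (m $ 1) (m $ 2) (m $ 3)"
proof -
  have lin: "lin_form l v = l $ 1 * v $ 1 + l $ 2 * v $ 2 + l $ 3 * v $ 3" for l v :: "'a^3"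
    by (simp add: lin_form_def sum_3)
  have form: "(\<forall>v. quad_form (conic_matrix a b c h g f) v = lin_form l v * lin_form m v) \<longleftrightarrow>
     a = l $ 1 * m $ 1 \<and> b = l $ 2 * m $ 2 \<and> c = l $ 3 * m $ 3 \<and>
     h = l $ 1 * m $ 2 + l $ 2 * m $ 1 \<and> g = l $ 1 * m $ 3 + l $ 3 * m $ 1 \<and>
     f = l $ 2 * m $ 3 + l $ 3 * m $ 2" (is "(\<forall>v. ?E v) \<longleftrightarrow> ?R")
  proof
    assume E: "\<forall>v. ?E v"
    have "?E (vector [1, 0, 0])" "?E (vector [0, 1, 0])" "?E (vector [0, 0, 1])"
      using E by blast+
    then have 1: "a = l $ 1 * m $ 1" "b = l $ 2 * m $ 2" "c = l $ 3 * m $ 3"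
      by (simp_all add: quad_form_conic[OF two] lin vector_3)
    have "?E (vector [1, 1, 0])" "?E (vector [1, 0, 1])" "?E (vector [0, 1, 1])"
      using E by blast+
    with 1 show ?R
      by (simp add: quad_form_conic[OF two] lin vector_3 algebra_simps)
  next
    assume ?R
    then show "\<forall>v. ?E v"
      by (auto simp: quad_form_conic[OF two] lin algebra_simps power2_eq_square)
  qed
  have indep: "l \<noteq> 0 \<and> m \<noteq> 0 \<and> (\<nexists>t. m = t *s l) \<longleftrightarrow>
     l $ 1 * m $ 2 \<noteq> l $ 2 * m $ 1 \<or> l $ 1 * m $ 3 \<noteq> l $ 3 * m $ 1 \<or> l $ 2 * m $ 3 \<noteq> l $ 3 * m $ 2"
    (is "?L \<longleftrightarrow> ?R")
  proof
    assume L: ?L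
    show ?R
    proof (rule ccontr)
      assume nR: "\<not> ?R"
      from L obtain i where i: "l $ i \<noteq> 0" by (auto simp: vec_eq_iff)
      have "m = (m $ i / l $ i) *s l"
        using nR i exhaust_3[of i] by (auto simp: vec_eq_iff forall_3 field_simps)
      with L show False by blast
    qed
  next
    assume ?R
    then show ?L by auto
  qed
  show ?thesis
    unfolding union_of_distinct_lines_def line_pair_def form using indep by blast
qed

lemma valid_conics_iff:
  fixes a b c h g f a' b' c' h' g' f' :: "'a::field"
  defines "A \<equiv> conic_matrix a b c h g f" and "B \<equiv> conic_matrix a' b' c' h' g' f'"
  defines "D \<equiv> dual_form (to_ac a') (to_ac b') (to_ac c') (to_ac h') (to_ac g') (to_ac f')"
  assumes two: "(2::'a) \<noteq> 0" and A: "\<not> smooth_conic A" and B: "smooth_conic B"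
  shows "valid_conics A B \<longleftrightarrow> (\<exists>l1 l2 l3 m1 m2 m3.
     line_pair (to_ac a) (to_ac b) (to_ac c) (to_ac h) (to_ac g) (to_ac f) l1 l2 l3 m1 m2 m3 \<and>
     D l1 l2 l3 \<noteq> 0 \<and> D m1 m2 m3 \<noteq> 0)"
proof -
  have two': "(2::'a alg_closure) \<noteq> 0"
    using two by (metis to_ac_eq_0_iff to_ac_numeral)
  have "det (over_closure B) \<noteq> 0"
    using B by (simp add: det_over_closure smooth_conic_def invertible_det_nz)
  then have T: "tangent_line (over_closure B) l \<longleftrightarrow> D (l $ 1) (l $ 2) (l $ 3) = 0" if "l \<noteq> 0" for l
    unfolding B_def over_closure_conic_matrix D_def by (rule tangent_line_iff[OF two' _ that])
  have U: "union_of_distinct_lines (over_closure A) l m \<longleftrightarrow>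
      line_pair (to_ac a) (to_ac b) (to_ac c) (to_ac h) (to_ac g) (to_ac f)
        (l $ 1) (l $ 2) (l $ 3) (m $ 1) (m $ 2) (m $ 3)" for l m
    unfolding A_def over_closure_conic_matrix by (rule union_of_distinct_lines_iff[OF two'])
  have "valid_conics A B \<longleftrightarrow> (\<exists>l m. union_of_distinct_lines (over_closure A) l m \<and>
      D (l $ 1) (l $ 2) (l $ 3) \<noteq> 0 \<and> D (m $ 1) (m $ 2) (m $ 3) \<noteq> 0)"
    using A B T unfolding valid_conics_def union_of_distinct_lines_def by metis
  also have "\<dots> \<longleftrightarrow> (\<exists>l1 l2 l3 m1 m2 m3.
     line_pair (to_ac a) (to_ac b) (to_ac c) (to_ac h) (to_ac g) (to_ac f) l1 l2 l3 m1 m2 m3 \<and>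
     D l1 l2 l3 \<noteq> 0 \<and> D m1 m2 m3 \<noteq> 0)" (is "?L \<longleftrightarrow> ?R")
  proof
    assume ?L then show ?R unfolding U by blast
  next
    assume ?R
    then obtain l1 l2 l3 m1 m2 m3 where *: "line_pair (to_ac a) (to_ac b) (to_ac c) (to_ac h) (to_ac g) (to_ac f) l1 l2 l3 m1 m2 m3"
      "D l1 l2 l3 \<noteq> 0" "D m1 m2 m3 \<noteq> 0" by blast
    show ?L unfolding U
      by (rule exI[of _ "vector [l1, l2, l3]"], rule exI[of _ "vector [m1, m2, m3]"])
         (use * in \<open>simp add: vector_3\<close>)
  qed
  finally show ?thesis .
qed

text \<open>
  The singular conic with coefficients \<open>a, ..., f\<close> is, over the algebraic closure, the union of two
  distinct lines that are not tangent to the conic with coefficients \<open>a', ..., f'\<close>.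
\<close>

definition secant_lines ::
  "'a::field \<Rightarrow> 'a \<Rightarrow> 'a \<Rightarrow> 'a \<Rightarrow> 'a \<Rightarrow> 'a \<Rightarrow> 'a \<Rightarrow> 'a \<Rightarrow> 'a \<Rightarrow> 'a \<Rightarrow> 'a \<Rightarrow> 'a \<Rightarrow> bool" where
  "secant_lines a b c h g f a' b' c' h' g' f' \<longleftrightarrow> (\<exists>l1 l2 l3 m1 m2 m3.
     line_pair (to_ac a) (to_ac b) (to_ac c) (to_ac h) (to_ac g) (to_ac f) l1 l2 l3 m1 m2 m3 \<and>
     dual_form (to_ac a') (to_ac b') (to_ac c') (to_ac h') (to_ac g') (to_ac f') l1 l2 l3 \<noteq> 0 \<and>
     dual_form (to_ac a') (to_ac b') (to_ac c') (to_ac h') (to_ac g') (to_ac f') m1 m2 m3 \<noteq> 0)"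

lemmas secant_linesI = secant_lines_def[THEN iffD2, OF exI, OF exI, OF exI, OF exI, OF exI, OF exI, OF conjI[OF _ conjI]]

lemma line_pair_double_line:
  "\<not> line_pair 1 0 0 0 0 0 l1 l2 l3 m1 m2 m3" "\<not> line_pair 0 0 1 0 0 0 l1 l2 l3 m1 m2 m3"
  unfolding line_pair_def by (auto simp: add_eq_0_iff)

lemma line_pair_coordinate_lines:
  assumes "line_pair 0 0 0 1 0 0 l1 l2 l3 m1 m2 m3"
  obtains "l2 = 0" "l3 = 0" "m1 = 0" "m3 = 0" | "l1 = 0" "l3 = 0" "m2 = 0" "m3 = 0"
proof -
  have "l1 * m1 = 0" "l2 * m2 = 0" "l3 * m3 = 0" "l1 * m2 + l2 * m1 = 1" "l1 * m3 + l3 * m1 = 0"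
     "l2 * m3 + l3 * m2 = 0"
    using assms unfolding line_pair_def by metis+
  then show thesis using that by (cases "l1 = 0") auto
qed

lemma member_conic:
  "member (conic_matrix a b c h g f, conic_matrix a' b' c' h' g' f') r =
     conic_matrix (hx r * a + hy r * a') (hx r * b + hy r * b') (hx r * c + hy r * c')
       (hx r * h + hy r * h') (hx r * g + hy r * g') (hx r * f + hy r * f')"
  unfolding member_eq by (simp add: conic_matrix_def vec_eq_iff forall_3 vector_3 add_divide_distrib)

text \<open>
  Since \<open>A\<close> is singular, the second conic of a valid pair has an affine parameter.
\<close>

lemma good_singularI:
  fixes a b c h g f a' b' c' h' g' f' :: "'a::field"
  defines "A \<equiv> conic_matrix a b c h g f" and "B \<equiv> conic_matrix a' b' c' h' g' f'"
  assumes two: "(2::'a) \<noteq> 0" and P: "pencil_cubic (A, B) 0 p1 p2 p3"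
    and None: "\<And>t. p1 * t\<^sup>2 + p2 * t + p3 \<noteq> 0 \<Longrightarrow>
      secant_lines a b c h g f (t * a + a') (t * b + b') (t * c + c')
        (t * h + h') (t * g + g') (t * f + f') \<longleftrightarrow> None \<in> G"
    and Some: "\<And>x t. p1 * x\<^sup>2 + p2 * x + p3 = 0 \<Longrightarrow> p1 * t\<^sup>2 + p2 * t + p3 \<noteq> 0 \<Longrightarrow>
      secant_lines (x * a + a') (x * b + b') (x * c + c')
        (x * h + h') (x * g + g') (x * f + f') (t * a + a') (t * b + b') (t * c + c')
        (t * h + h') (t * g + g') (t * f + f') \<longleftrightarrow> Some x \<in> G"
    and G: "\<And>x. Some x \<in> G \<Longrightarrow> p1 * x\<^sup>2 + p2 * x + p3 = 0"
  shows "good_singular (A, B) G"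
  unfolding good_singular_def
proof (intro conjI ballI allI impI)
  fix r assume "r \<in> G"
  then show "\<not> smooth_conic (member (A, B) r)"
    using G by (cases r) (auto simp: smooth_member[OF P] cubic_def simp del: member.simps)
next
  fix r s assume r: "\<not> smooth_conic (member (A, B) r)" and s: "smooth_conic (member (A, B) s)"
  from s obtain t where t: "s = Some t" and qt: "p1 * t\<^sup>2 + p2 * t + p3 \<noteq> 0"
    by (cases s) (auto simp: smooth_member[OF P] cubic_def simp del: member.simps)
  note valid = valid_conics_iff[OF two r[unfolded A_def B_def member_conic]
      s[unfolded A_def B_def member_conic], folded secant_lines_def]
  show "valid_conics (member (A, B) r) (member (A, B) s) \<longleftrightarrow> r \<in> G"
    unfolding A_def B_def member_conic valid
    using None[OF qt] Some[OF _ qt] r by (cases r) (auto simp: t smooth_member[OF P] cubic_def simp del: member.simps)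
qed

section \<open>The cubics and the admissible singular members of the pencils\<close>

lemmas pencil_cubic_simps = pencil_cubic_def conic_matrix_def det_3 mixed_det_3 vector_3

context
  assumes two: "(2::'a::field) \<noteq> 0"
begin

lemma cubic_pencil3: "pencil_cubic (pencil3 :: 'a pencil) 0 (-1/4) (1/4) 0"
  using two two_powers_neq_0[OF two] by (simp add: pencil_cubic_simps pencil3_def field_simps)

lemma cubic_pencil4: "pencil_cubic (pencil4 :: 'a pencil) 0 (-1/4) 0 0"
  using two two_powers_neq_0[OF two] by (simp add: pencil_cubic_simps pencil4_def field_simps)

lemma cubic_pencil5: "pencil_cubic (pencil5 :: 'a pencil) 0 0 0 (-1/4)"
  using two two_powers_neq_0[OF two] by (simp add: pencil_cubic_simps pencil5_def field_simps)

lemma cubic_pencil6: "pencil_cubic (pencil6 :: 'a pencil) 0 (-1/4) 0 0"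
  using two two_powers_neq_0[OF two] by (simp add: pencil_cubic_simps pencil6_def field_simps)

lemma cubic_pencil8: "pencil_cubic (pencil8 :: 'a pencil) 0 0 0 (-1/4)"
  using two two_powers_neq_0[OF two] by (simp add: pencil_cubic_simps pencil8_def field_simps)

lemma cubic_pencil14: "pencil_cubic (pencil14 e :: 'a pencil) 0 (-e/4) (1/4) (-1/4)"
  using two two_powers_neq_0[OF two] by (simp add: pencil_cubic_simps pencil14_def field_simps)

lemma cubic_pencil15: "pencil_cubic (pencil15 e :: 'a pencil) 0 (-e/4) 0 0"
  using two two_powers_neq_0[OF two] by (simp add: pencil_cubic_simps pencil15_def field_simps)

lemma cubic_pencil16:
  "pencil_cubic (pencil16 d e :: 'a pencil) 0 (-1/4) (1/4) ((4 * d * e - e - d) / 4)"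
  using two two_powers_neq_0[OF two] by (simp add: pencil_cubic_simps pencil16_def field_simps)

lemma cubic_pencil17: "pencil_cubic (pencil17 e :: 'a pencil) 0 0 ((4 * e - 1) / 4) 0"
  using two two_powers_neq_0[OF two] by (simp add: pencil_cubic_simps pencil17_def field_simps)

lemma cubic_pencil18: "pencil_cubic (pencil18 b c :: 'a pencil) (-1/4) (-b/4) (-c/4) (-1/4)"
  using two two_powers_neq_0[OF two] by (simp add: pencil_cubic_simps pencil18_def field_simps)

lemma cubic_pencil19: "pencil_cubic (pencil19 \<nu> \<rho> \<sigma> :: 'a pencil) 0 (-\<nu>) (-\<rho>) (-\<sigma>\<^sup>2)"
  using two two_powers_neq_0[OF two] by (simp add: pencil_cubic_simps pencil19_def field_simps power2_eq_square)

text \<open>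
  The four base points are distinct, and each singular member consists of two lines, each joining two of
  the base points: \<open>x y\<close>, \<open>z (x + y + z)\<close> and \<open>(x + z) (y + z)\<close>. A line through two distinct points of
  a smooth conic is not tangent.
\<close>

lemma good_pencil3: "good_singular (pencil3 :: 'a pencil) {r. cubic 0 (-1/4) (1/4) 0 r = 0}"
proof -
  have roots: "-1/4 * x\<^sup>2 + 1/4 * x + 0 = 0 \<longleftrightarrow> x = 0 \<or> x = 1" for x :: 'a
    using two_powers_neq_0[OF two] by (auto simp: field_simps power2_eq_square)
  have N: "secant_lines 0 0 0 1 0 0 0 0 1 t 1 1" for t :: 'a
    by (rule secant_linesI[of _ _ _ _ _ _ 1 0 0 0 1 0])
       (simp_all add: line_pair_def dual_form_def)
  have 0: "secant_lines 0 0 1 0 1 1 0 0 1 t 1 1" if "t \<noteq> 0" for t :: 'a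
  proof -
    have "dual_form 0 0 1 (to_ac t) 1 1 1 1 1 = - ((to_ac t)\<^sup>2)"
      by (simp add: dual_form_def algebra_simps)
    with that show ?thesis
      by (intro secant_linesI[of _ _ _ _ _ _ 0 0 1 1 1 1])
         (simp_all add: line_pair_def, simp_all add: dual_form_def)
  qed
  have 1: "secant_lines 0 0 1 1 1 1 0 0 1 t 1 1" if "t \<noteq> 1" for t :: 'a
  proof -
    have "dual_form 0 0 1 (to_ac t) 1 1 1 0 1 = - ((to_ac t - 1)\<^sup>2)"
      "dual_form 0 0 1 (to_ac t) 1 1 0 1 1 = - ((to_ac t - 1)\<^sup>2)"
      by (simp_all add: dual_form_def algebra_simps power2_eq_square)
    moreover have "to_ac t - 1 \<noteq> 0" using that by simp
    ultimately show ?thesis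
      by (intro secant_linesI[of _ _ _ _ _ _ 1 0 1 0 1 1])
         (simp_all add: line_pair_def)
  qed
  have "{r. cubic 0 (-1/4) (1/4) 0 r = 0} = {None, Some 0, Some (1::'a)}"
    by (auto simp only: Collect_option cubic_simps roots) auto
  then show ?thesis
    unfolding pencil3_def
    by (intro good_singularI[OF two cubic_pencil3[unfolded pencil3_def]], unfold roots)
       (use N 0 1 in auto)
qed

text \<open>
  The line \<open>x = 0\<close> touches all smooth members, whose equation reduces to \<open>z\<^sup>2 = 0\<close> on it; this excludes
  \<open>x y\<close>. The other singular member is \<open>z (x + z)\<close>.
\<close>

lemma good_pencil4: "good_singular (pencil4 :: 'a pencil) {Some 0}"
proof -
  have roots: "-1/4 * x\<^sup>2 + 0 * x + 0 = 0 \<longleftrightarrow> x = 0" for x :: 'a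
    using two_powers_neq_0[OF two] by auto
  have N: "\<not> secant_lines 0 0 0 1 0 0 0 0 1 t 1 0" for t :: 'a
    by (auto simp: secant_lines_def dual_form_def elim!: line_pair_coordinate_lines)
  have 0: "secant_lines 0 0 1 0 1 0 0 0 1 t 1 0" if "t \<noteq> 0" for t :: 'a
    using that by (intro secant_linesI[of _ _ _ _ _ _ 0 0 1 1 0 1])
      (simp_all add: line_pair_def dual_form_def)
  show ?thesis
    unfolding pencil4_def
    by (rule good_singularI[OF two cubic_pencil4[unfolded pencil4_def]], unfold roots)
       (use N 0 in auto)
qed

text \<open>
  On the line \<open>x = 0\<close> the equation of a smooth member is \<open>y\<^sup>2 = 0\<close>, which excludes \<open>x y\<close>.
\<close>

lemma good_pencil5: "good_singular (pencil5 :: 'a pencil) {}"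
proof -
  have "\<not> secant_lines 0 0 0 1 0 0 0 1 0 t 1 0" for t :: 'a
    by (auto simp: secant_lines_def dual_form_def elim!: line_pair_coordinate_lines)
  then show ?thesis
    unfolding pencil5_def using two_powers_neq_0[OF two]
    by (intro good_singularI[OF two cubic_pencil5[unfolded pencil5_def]]) auto
qed

text \<open>
  The lines of \<open>x y\<close> are both tangent, and \<open>z\<^sup>2\<close> is a double line.
\<close>

lemma good_pencil6: "good_singular (pencil6 :: 'a pencil) {}"
proof -
  have "\<not> secant_lines 0 0 0 1 0 0 0 0 1 t 0 0" "\<not> secant_lines 0 0 1 0 0 0 0 0 1 t 0 0" for t :: 'a
    by (auto simp: secant_lines_def dual_form_def line_pair_double_line
        elim!: line_pair_coordinate_lines)
  then show ?thesis
    unfolding pencil6_def using two_powers_neq_0[OF two]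
    by (intro good_singularI[OF two cubic_pencil6[unfolded pencil6_def]]) auto
qed

lemma good_pencil8: "good_singular (pencil8 :: 'a pencil) {}"
proof -
  have "\<not> secant_lines 1 0 0 0 0 0 t 0 1 1 0 0" for t :: 'a
    by (auto simp: secant_lines_def line_pair_double_line)
  then show ?thesis
    unfolding pencil8_def using two_powers_neq_0[OF two]
    by (intro good_singularI[OF two cubic_pencil8[unfolded pencil8_def]]) auto
qed

text \<open>
  The lines \<open>x = 0\<close> and \<open>y = 0\<close> meet the smooth members in the zeros of \<open>y\<^sup>2 + y z + e z\<^sup>2\<close> and of
  \<open>x z + e z\<^sup>2\<close>, which are distinct. The quadratic factor of the cubic has discriminant \<open>1 - 4 e\<close>, up to
  squares, so that there are no other singular members.
\<close>

lemma good_pencil14: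
  assumes e: "\<nexists>x::'a. 1 - 4 * e = x\<^sup>2"
  shows "good_singular (pencil14 e :: 'a pencil) {r. cubic 0 (-e/4) (1/4) (-1/4) r = 0}"
proof -
  have roots: "-e/4 * x\<^sup>2 + 1/4 * x + -1/4 \<noteq> 0" for x :: 'a
  proof
    assume root: "-e/4 * x\<^sup>2 + 1/4 * x + -1/4 = 0"
    have "4 * (-e/4 * x\<^sup>2 + 1/4 * x + -1/4) = x - e * x\<^sup>2 - 1"
      using two_powers_neq_0[OF two] by (simp add: field_simps)
    with root have "x - e * x\<^sup>2 - 1 = 0" by (metis mult_zero_right)
    moreover have "1 - 4 * e - (1 - 2 * e * x)\<^sup>2 = 4 * e * (x - e * x\<^sup>2 - 1)"
      by (simp add: algebra_simps power2_eq_square)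
    ultimately have "1 - 4 * e = (1 - 2 * e * x)\<^sup>2" by simp
    with e show False by blast
  qed
  have "secant_lines 0 0 0 1 0 0 0 1 e t 1 1" for t :: 'a
  proof -
    have "4 * e \<noteq> 1" using e by (metis cancel_comm_monoid_add_class.diff_cancel zero_power2)
    then have "to_ac (4 * e) \<noteq> 1" by (simp only: to_ac_eq_1_iff not_False_eq_True)
    then show ?thesis
      by (intro secant_linesI[of _ _ _ _ _ _ 1 0 0 0 1 0])
         (simp_all add: line_pair_def dual_form_def)
  qed
  then show ?thesis
    unfolding pencil14_def
    by (intro good_singularI[OF two cubic_pencil14[unfolded pencil14_def]])
      (use roots in \<open>auto simp: cubic_simps\<close>)
qed

text \<open>
  Over the algebraic closure, \<open>T\<^sup>2 + T + e\<close> has the roots \<open>(- 1 \<plusminus> w) / 2\<close>.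
\<close>

lemma factor_quadratic_form:
  fixes e :: 'a
  obtains w where "to_ac e = (1 - w\<^sup>2) / 4" "w = 0 \<longleftrightarrow> 1 - 4 * e = 0"
proof -
  obtain w where w: "w\<^sup>2 = to_ac (1 - 4 * e)"
    using nth_root_exists[of 2 "to_ac (1 - 4 * e)"] by auto
  have "(4::'a alg_closure) \<noteq> 0"
    using two_powers_neq_0[OF two] by (metis to_ac_eq_0_iff to_ac_numeral)
  with w have "to_ac e = (1 - w\<^sup>2) / 4" by (simp add: field_simps)
  moreover have "w = 0 \<longleftrightarrow> 1 - 4 * e = 0"
    using w by (metis to_ac_eq_0_iff power2_eq_iff_nonneg zero_eq_power2)
  ultimately show thesis using that by blast
qed

text \<open>
  On the line \<open>y = 0\<close> the equation of a smooth member is \<open>e z\<^sup>2 = 0\<close>, which excludes \<open>x y\<close>. The member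
  \<open>y\<^sup>2 + y z + e z\<^sup>2\<close> is a pair of distinct lines \<open>y + k z = 0\<close> with \<open>k \<noteq> 0\<close>, and each meets the smooth
  members in the two distinct points with \<open>x z = 0\<close>.
\<close>

lemma good_pencil15:
  assumes e: "e \<noteq> 0" "1 - 4 * e \<noteq> 0"
  shows "good_singular (pencil15 e :: 'a pencil) {Some 0}"
proof -
  have roots: "-e/4 * x\<^sup>2 + 0 * x + 0 = 0 \<longleftrightarrow> x = 0" for x :: 'a
    using two_powers_neq_0[OF two] e by auto
  have N: "\<not> secant_lines 0 0 0 1 0 0 0 1 e t 0 1" for t :: 'a
    by (auto simp: secant_lines_def dual_form_def elim!: line_pair_coordinate_lines)
  have 0: "secant_lines 0 1 e 0 0 1 0 1 e t 0 1" if "t \<noteq> 0" for t :: 'a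
  proof -
    obtain w where w: "to_ac e = (1 - w\<^sup>2) / 4" "w = 0 \<longleftrightarrow> 1 - 4 * e = 0"
      by (rule factor_quadratic_form)
    define k1 k2 where "k1 = (1 - w) / 2" and "k2 = (1 + w) / 2"
    have two': "(2::'a alg_closure) \<noteq> 0" "(4::'a alg_closure) \<noteq> 0"
      using two two_powers_neq_0[OF two] by (metis to_ac_eq_0_iff to_ac_numeral)+
    have k: "to_ac e = k1 * k2" "k2 + k1 = 1" "k2 - k1 = w"
      using two' by (auto simp: w k1_def k2_def field_simps power2_eq_square)
    with e w have "k2 \<noteq> k1" "k1 \<noteq> 0" "k2 \<noteq> 0" by auto
    with that k show ?thesis
      by (intro secant_linesI[of _ _ _ _ _ _ 0 1 k1 0 1 k2])
        (simp_all add: line_pair_def dual_form_def)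
  qed
  show ?thesis
    unfolding pencil15_def
    by (rule good_singularI[OF two cubic_pencil15[unfolded pencil15_def]], unfold roots)
       (use N 0 in auto)
qed

text \<open>
  The base points are the zeros of \<open>z\<^sup>2 + y z + d y\<^sup>2\<close> on \<open>x = 0\<close> and of \<open>z\<^sup>2 + x z + e x\<^sup>2\<close> on \<open>y = 0\<close>.
  A singular member other than \<open>x y\<close> consists of two lines, each joining a base point on \<open>x = 0\<close> to one
  on \<open>y = 0\<close>; the two ways of matching the points correspond to the two roots of the quadratic factor
  of the cubic.
\<close>

lemma good_pencil16:
  assumes d: "1 - 4 * d \<noteq> 0" and e: "1 - 4 * e \<noteq> 0"
  shows "good_singular (pencil16 d e :: 'a pencil)
    {r. cubic 0 (-1/4) (1/4) ((4 * d * e - e - d) / 4) r = 0}"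
proof -
  let ?q = "\<lambda>x. -1/4 * x\<^sup>2 + 1/4 * x + (4 * d * e - e - d) / 4"
  have two': "(2::'a alg_closure) \<noteq> 0" "(4::'a alg_closure) \<noteq> 0"
    using two two_powers_neq_0[OF two] by (metis to_ac_eq_0_iff to_ac_numeral)+
  have N: "secant_lines 0 0 0 1 0 0 e d 1 t 1 1" for t :: 'a
  proof -
    have "4 * d \<noteq> 1" "4 * e \<noteq> 1" using d e by auto
    then have "to_ac (4 * d) \<noteq> 1" "to_ac (4 * e) \<noteq> 1"
      by (simp_all only: to_ac_eq_1_iff not_False_eq_True)
    then show ?thesis
      by (intro secant_linesI[of _ _ _ _ _ _ 1 0 0 0 1 0])
         (simp_all add: line_pair_def dual_form_def)
  qed
  have S: "secant_lines e d 1 x 1 1 e d 1 t 1 1" if x: "?q x = 0" and t: "?q t \<noteq> 0" for x t :: 'a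
  proof -
    obtain w where w: "to_ac d = (1 - w\<^sup>2) / 4" "w = 0 \<longleftrightarrow> 1 - 4 * d = 0"
      by (rule factor_quadratic_form)
    obtain v0 where v0: "to_ac e = (1 - v0\<^sup>2) / 4" "v0 = 0 \<longleftrightarrow> 1 - 4 * e = 0"
      by (rule factor_quadratic_form)
    have "4 * ?q x = 4 * d * e - e - d - x\<^sup>2 + x"
      using two_powers_neq_0[OF two] by (simp add: field_simps)
    with x have "4 * d * e - e - d - x\<^sup>2 + x = 0" by (metis mult_zero_right)
    moreover have "(2 * x - 1)\<^sup>2 - (1 - 4 * d) * (1 - 4 * e) = - 4 * (4 * d * e - e - d - x\<^sup>2 + x)"
      by (simp add: algebra_simps power2_eq_square)
    ultimately have "(2 * x - 1)\<^sup>2 = (1 - 4 * d) * (1 - 4 * e)" by simp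
    then have "(2 * to_ac x - 1)\<^sup>2 = (1 - 4 * to_ac d) * (1 - 4 * to_ac e)"
      by (metis to_ac_1 to_ac_diff to_ac_mult to_ac_numeral to_ac_power)
    also have "\<dots> = (v0 * w)\<^sup>2" using two' by (simp add: w v0 power_mult_distrib)
    finally have pm: "2 * to_ac x - 1 = v0 * w \<or> 2 * to_ac x - 1 = - (v0 * w)"
      by (simp add: power2_eq_iff)
    \<comment> \<open>The sign of the square root of \<open>1 - 4 e\<close> decides which of the two matchings is taken.\<close>
    define v where "v = (if 2 * to_ac x - 1 = v0 * w then - v0 else v0)"
    have v: "2 * to_ac x - 1 = - (v * w)" "v = v0 \<or> v = - v0"
      using pm by (auto simp: v_def)
    \<comment> \<open>The lines are \<open>k\<^sub>1 x + m\<^sub>1 y + z = 0\<close> and \<open>k\<^sub>2 x + m\<^sub>2 y + z = 0\<close>.\<close>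
    define k1 k2 m1 m2 where km: "k1 = (1 - v) / 2" "k2 = (1 + v) / 2" "m1 = (1 - w) / 2" "m2 = (1 + w) / 2"
    have e': "to_ac e = k1 * k2" "k2 = 1 - k1" "k2 - k1 = v"
      using two' v(2) by (auto simp: v0 km field_simps power2_eq_square)
    have d': "to_ac d = m1 * m2" "m2 = 1 - m1" "m2 - m1 = w"
      using two' by (auto simp: w km field_simps power2_eq_square)
    have "2 * to_ac x = 1 - v * w" using v(1) by (simp add: algebra_simps)
    also have "\<dots> = 2 * (k1 * m2 + m1 * k2)"
      unfolding e'(3)[symmetric] d'(3)[symmetric] e'(2) d'(2) by (simp add: algebra_simps)
    finally have x': "to_ac x = k1 * m2 + m1 * k2" using two'(1) by (metis mult_left_cancel)
    have "k1 \<noteq> k2" using e'(3) v(2) v0(2) e by auto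
    moreover have "dual_form (to_ac e) (to_ac d) 1 (to_ac t) 1 1 k1 m1 1 = - ((to_ac t - to_ac x)\<^sup>2)"
      "dual_form (to_ac e) (to_ac d) 1 (to_ac t) 1 1 k2 m2 1 = - ((to_ac t - to_ac x)\<^sup>2)"
      unfolding e'(1,2) d'(1,2) x' dual_form_def by (simp_all add: algebra_simps power2_eq_square)
    moreover have "to_ac t - to_ac x \<noteq> 0" using x t by auto
    ultimately show ?thesis
      by (intro secant_linesI[of _ _ _ _ _ _ k1 m1 1 k2 m2 1])
         (simp_all add: line_pair_def e'(1) d'(1) x', simp_all add: e'(2) d'(2))
  qed
  show ?thesis
    unfolding pencil16_def
    by (rule good_singularI[OF two cubic_pencil16[unfolded pencil16_def]])
       (use N S in \<open>simp_all add: cubic_simps\<close>)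
qed

text \<open>
  The member \<open>x\<^sup>2\<close> is a double line. The lines of \<open>y\<^sup>2 + y z + e z\<^sup>2\<close> pass through \<open>(1 : 0 : 0)\<close>, and on
  them the equation of a smooth member is \<open>x\<^sup>2 = 0\<close>.
\<close>

lemma good_pencil17:
  assumes e: "1 - 4 * e \<noteq> 0"
  shows "good_singular (pencil17 e :: 'a pencil) {}"
proof -
  have roots: "0 * x\<^sup>2 + (4 * e - 1) / 4 * x + 0 = 0 \<longleftrightarrow> x = 0" for x :: 'a
    using two_powers_neq_0[OF two] e by auto
  have N: "\<not> secant_lines 1 0 0 0 0 0 t 1 e 0 0 1" for t :: 'a
    by (auto simp: secant_lines_def line_pair_double_line)
  have 0: "\<not> secant_lines 0 1 e 0 0 1 t 1 e 0 0 1" for t :: 'a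
  proof
    assume "secant_lines 0 1 e 0 0 1 t 1 e 0 0 1"
    then obtain l1 l2 l3 m1 m2 m3 where
      l: "l1 * m1 = 0" "l2 * m2 = 1" "to_ac e = l3 * m3" "l1 * m2 + l2 * m1 = 0" "l2 * m3 + l3 * m2 = 1"
      and D: "dual_form (to_ac t) 1 (to_ac e) 0 0 1 l1 l2 l3 \<noteq> 0"
      unfolding secant_lines_def line_pair_def by (metis to_ac_0 to_ac_1)
    from l have "l1 = 0" by auto
    then have "dual_form (to_ac t) 1 (to_ac e) 0 0 1 l1 l2 l3 =
        4 * to_ac t * (l3 * m3 * l2\<^sup>2 + l3\<^sup>2 * (l2 * m2) - l2 * l3 * (l2 * m3 + l3 * m2))"
      unfolding l(2,5) by (simp add: dual_form_def l(3) algebra_simps power2_eq_square)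
    also have "\<dots> = 0" by (simp add: algebra_simps power2_eq_square)
    finally show False using D by simp
  qed
  show ?thesis
    unfolding pencil17_def
    by (rule good_singularI[OF two cubic_pencil17[unfolded pencil17_def]], unfold roots)
       (use N 0 in auto)
qed

lemma cubic_pencil18_neq_0:
  assumes "\<And>x::'a. x ^ 3 + b * x\<^sup>2 + c * x + 1 \<noteq> 0"
  shows "cubic (-1/4) (-b/4) (-c/4) (-1/4) r \<noteq> (0::'a)"
proof (cases r)
  case None
  then show ?thesis using two_powers_neq_0[OF two] by (simp add: cubic_simps)
next
  case (Some x)
  have "4 * cubic (-1/4) (-b/4) (-c/4) (-1/4) r = - (x ^ 3 + b * x\<^sup>2 + c * x + 1)"
    using two_powers_neq_0[OF two] by (simp add: Some cubic_def field_simps)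
  with assms[of x] show ?thesis by (metis mult_zero_right neg_equal_0_iff_equal)
qed

text \<open>
  The lines \<open>x = \<plusminus> n y\<close> with \<open>n\<^sup>2 = \<nu>\<close> would be tangent only if \<open>\<rho>\<^sup>2 = 4 \<nu> \<sigma>\<^sup>2\<close>. That
  \<open>\<rho>\<^sup>2 - 4 \<nu> \<sigma>\<^sup>2\<close> is no square also shows that there are no other singular members.
\<close>

lemma good_pencil19:
  assumes nu: "\<nexists>x::'a. \<nu> = x\<^sup>2" and disc: "\<nexists>x::'a. \<rho>\<^sup>2 - 4 * \<nu> * \<sigma>\<^sup>2 = x\<^sup>2"
  shows "good_singular (pencil19 \<nu> \<rho> \<sigma> :: 'a pencil) {r. cubic 0 (-\<nu>) (-\<rho>) (-\<sigma>\<^sup>2) r = 0}"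
proof -
  have roots: "-\<nu> * x\<^sup>2 + -\<rho> * x + -\<sigma>\<^sup>2 \<noteq> 0" for x :: 'a
  proof
    assume root: "-\<nu> * x\<^sup>2 + -\<rho> * x + -\<sigma>\<^sup>2 = 0"
    have "\<rho>\<^sup>2 - 4 * \<nu> * \<sigma>\<^sup>2 - (2 * \<nu> * x + \<rho>)\<^sup>2 = 4 * \<nu> * (-\<nu> * x\<^sup>2 + -\<rho> * x + -\<sigma>\<^sup>2)"
      by (simp add: algebra_simps power2_eq_square)
    with root have "\<rho>\<^sup>2 - 4 * \<nu> * \<sigma>\<^sup>2 = (2 * \<nu> * x + \<rho>)\<^sup>2" by (metis mult_zero_right right_minus_eq)
    with disc show False by blast
  qed
  have two': "(2::'a alg_closure) \<noteq> 0" "(4::'a alg_closure) \<noteq> 0"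
    using two two_powers_neq_0[OF two] by (metis to_ac_eq_0_iff to_ac_numeral)+
  obtain n where n: "n\<^sup>2 = to_ac \<nu>"
    using nth_root_exists[of 2 "to_ac \<nu>"] by auto
  have n0: "n \<noteq> 0" using n neq_0_if_nonsquare[OF nu] by auto
  have "secant_lines 1 (-\<nu>) 0 0 0 0 t (- (t * \<nu>) - \<rho>) 1 (2 * \<sigma>) 0 0" for t :: 'a
  proof -
    have D: "dual_form (to_ac t) (- (to_ac t * to_ac \<nu>) - to_ac \<rho>) 1 (2 * to_ac \<sigma>) 0 0 1 m 0 \<noteq> 0"
      if m: "m\<^sup>2 = to_ac \<nu>" for m
    proof -
      have "to_ac \<rho> + 2 * m * to_ac \<sigma> \<noteq> 0"
      proof
        assume "to_ac \<rho> + 2 * m * to_ac \<sigma> = 0"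
        then have "to_ac \<rho> = - (2 * m * to_ac \<sigma>)" by (simp add: eq_neg_iff_add_eq_0)
        then have "(to_ac \<rho>)\<^sup>2 - 4 * m\<^sup>2 * (to_ac \<sigma>)\<^sup>2 = 0" by (simp add: power_mult_distrib)
        then have "to_ac (\<rho>\<^sup>2 - 4 * \<nu> * \<sigma>\<^sup>2) = 0" by (simp add: m)
        then show False using neq_0_if_nonsquare[OF disc] by (simp only: to_ac_eq_0_iff)
      qed
      moreover have "dual_form (to_ac t) (- (to_ac t * to_ac \<nu>) - to_ac \<rho>) 1 (2 * to_ac \<sigma>) 0 0 1 m 0 =
          - 4 * (to_ac \<rho> + 2 * m * to_ac \<sigma>)"
        by (simp add: dual_form_def m algebra_simps)
      ultimately show ?thesis using two' by (metis mult_eq_0_iff neg_equal_0_iff_equal)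
    qed
    have "n + n \<noteq> 0" using n0 two' by (metis mult_2 mult_eq_0_iff)
    then have "n \<noteq> - n" by (simp add: eq_neg_iff_add_eq_0)
    then have "line_pair 1 (- to_ac \<nu>) 0 0 0 0 1 n 0 1 (- n) 0"
      by (simp add: line_pair_def flip: n) (simp add: power2_eq_square)
    then show ?thesis
      by (intro secant_linesI[of _ _ _ _ _ _ 1 n 0 1 "-n" 0])
        (use D[of n] D[of "-n"] n in simp_all)
  qed
  then show ?thesis
    unfolding pencil19_def
    by (intro good_singularI[OF two cubic_pencil19[unfolded pencil19_def]])
      (use roots in \<open>auto simp: cubic_simps\<close>)
qed

end

section \<open>Reducible and irreducible polynomials of low degree\<close>

lemma irreducible_imp_no_root:
  fixes p :: "'a::field poly"
  assumes "Factorial_Ring.irreducible p" "Polynomial.degree p \<ge> 2"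
  shows "poly p x \<noteq> 0"
proof
  assume "poly p x = 0"
  then obtain q where q: "p = [:-x, 1:] * q" by (auto simp: poly_eq_0_iff_dvd dvd_def)
  with assms(1) have "is_unit [:-x, 1:] \<or> is_unit q" by (metis Factorial_Ring.irreducibleD)
  moreover have "\<not> is_unit [:-x, 1:]" by (simp add: is_unit_pCons_iff)
  ultimately have "is_unit q" by blast
  then have "Polynomial.degree q = 0" "q \<noteq> 0"
    by (auto simp: is_unit_poly_iff)
  then have "Polynomial.degree p = 1" unfolding q by (subst degree_mult_eq) auto
  with assms(2) show False by simp
qed

lemma nonsquare_disc_if_irreducible:
  assumes two: "(2::'a::field) \<noteq> 0" and irr: "Factorial_Ring.irreducible [:e::'a, 1, 1:]"
  shows "\<nexists>x. 1 - 4 * e = x\<^sup>2"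
proof
  assume "\<exists>x. 1 - 4 * e = x\<^sup>2"
  then obtain x where x: "1 - 4 * e = x\<^sup>2" ..
  have "4 * poly [:e, 1, 1:] ((x - 1) / 2) = x\<^sup>2 - (1 - 4 * e)"
    using two two_powers_neq_0[OF two] by (simp add: field_simps power2_eq_square)
  with x two_powers_neq_0[OF two] have "poly [:e, 1, 1:] ((x - 1) / 2) = 0"
    by (metis mult_eq_0_iff right_minus_eq)
  moreover have "Polynomial.degree [:e, 1, 1:] \<ge> 2" by simp
  ultimately show False using irreducible_imp_no_root[OF irr] by blast
qed

lemma cube_root_exists_char3:
  assumes three: "(3::'a::{field,finite}) = 0"
  shows "\<exists>x::'a. x ^ 3 = y"
proof -
  have "inj (\<lambda>x::'a. x ^ 3)"
  proof (rule injI)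
    fix x y :: 'a assume "x ^ 3 = y ^ 3"
    moreover have "(x - y) ^ 3 = x ^ 3 - y ^ 3 - 3 * (x * y * (x - y))"
      by (simp add: algebra_simps power3_eq_cube)
    ultimately have "(x - y) ^ 3 = 0" by (simp add: three)
    then show "x = y" by simp
  qed
  then have "surj (\<lambda>x::'a. x ^ 3)" by (rule finite_UNIV_inj_surj[OF finite])
  then show ?thesis by (metis surjD)
qed

text \<open>
  A repeated root of a cubic over a finite field is rational: a root that is exactly double is given by
  a rational expression in the coefficients, and a triple root is \<open>- b / 3\<close>, or the cube root of \<open>- d\<close> in
  characteristic \<open>3\<close>, which exists because the Frobenius map is onto.
\<close>

lemma cubic_disc_neq_0_if_no_root:
  fixes b c d :: "'a::{field,finite}"
  assumes two: "(2::'a) \<noteq> 0" and noroot: "\<And>x. x ^ 3 + b * x\<^sup>2 + c * x + d \<noteq> 0"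
  shows "cubic_disc 1 b c d \<noteq> 0"
proof
  assume disc: "cubic_disc 1 b c d = 0"
  define h where "h = b\<^sup>2 - 3 * c"
  show False
  proof (cases "h = 0")
    case False
    \<comment> \<open>The usual expression for the double root of a cubic that has no triple root.\<close>
    define x where "x = (9 * d - b * c) / (2 * h)"
    have x: "2 * h * x = 9 * d - b * c" using False two by (simp add: x_def)
    have "8 * h ^ 3 * (x ^ 3 + b * x\<^sup>2 + c * x + d) =
      (2 * h * x) ^ 3 + 2 * b * h * (2 * h * x)\<^sup>2 + 4 * c * h\<^sup>2 * (2 * h * x) + 8 * d * h ^ 3"
      by (simp add: algebra_simps power2_eq_square power3_eq_cube)
    also have "\<dots> = - (27 * d - 9 * b * c + 2 * b ^ 3) * cubic_disc 1 b c d"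
      unfolding x unfolding h_def cubic_disc_def by (simp add: algebra_simps power2_eq_square power3_eq_cube)
    finally have "8 * h ^ 3 * (x ^ 3 + b * x\<^sup>2 + c * x + d) = 0" using disc by simp
    with noroot[of x] False two_powers_neq_0[OF two] show False by simp
  next
    case h: True
    show False
    proof (cases "(3::'a) = 0")
      case False
      then have "(27::'a) = 3 ^ 3" "(9::'a) = 3 ^ 2" by simp_all
      with False have n: "(27::'a) \<noteq> 0" "(9::'a) \<noteq> 0" by (metis power_not_zero)+
      define y where "y = b / 3"
      have b: "b = 3 * y" using False by (simp add: y_def)
      have "3 * (3 * y\<^sup>2 - c) = 0" using h by (simp add: h_def b power2_eq_square algebra_simps)
      with False have c: "c = 3 * y\<^sup>2" by (metis mult_eq_0_iff right_minus_eq)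
      have "cubic_disc 1 b c d = - 27 * (d - y ^ 3)\<^sup>2"
        unfolding b c cubic_disc_def by (simp add: algebra_simps power2_eq_square power3_eq_cube)
      with disc n have "d = y ^ 3" by simp
      then have "(-y) ^ 3 + b * (-y)\<^sup>2 + c * (-y) + d = 0"
        unfolding b c by (simp add: algebra_simps power2_eq_square power3_eq_cube)
      with noroot show False by blast
    next
      case three: True
      with h have b: "b = 0" by (simp add: h_def)
      have "(27::'a) = 9 * 3" by simp
      with three have "(27::'a) = 0" by simp
      with disc b two_powers_neq_0[OF two] have c: "c = 0" by (simp add: cubic_disc_def)
      obtain x where "x ^ 3 = - d" using cube_root_exists_char3[OF three] by blast
      with noroot[of x] b c show False by simp
    qed
  qed
qed

section \<open>Probabilities for squarefree cubics\<close>

lemma card_roots_cubic: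
  fixes b c d :: "'a::{field,finite}"
  assumes two: "(2::'a) \<noteq> 0" and b: "b \<noteq> 0"
  shows "int (card {r. cubic 0 b c d r = 0}) = 2 + qchar (c\<^sup>2 - 4 * b * d)"
proof -
  have "{r. cubic 0 b c d r = 0} = insert None {r. qform b c d r = 0}"
    by (auto simp: Collect_option cubic_simps qform_def)
  moreover have "None \<notin> {r. qform b c d r = 0}" using b by (simp add: qform_def)
  ultimately show ?thesis using card_zeros_qform[OF two, of b c d] b by simp
qed

lemma cubic_disc_scale:
  "cubic_disc (t * a) (t * b) (t * c) (t * d) = t ^ 4 * cubic_disc a b c d"
  by (simp add: cubic_disc_def algebra_simps power2_eq_square power3_eq_cube power4_eq_xxxx)

lemma cubic_disc_quadratic: "cubic_disc 0 b c d = b\<^sup>2 * (c\<^sup>2 - 4 * b * d)"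
  by (simp add: cubic_disc_def algebra_simps power2_eq_square power3_eq_cube)

lemma three_root_pencil:
  fixes P :: "'a::{field,finite} pencil"
  assumes two: "(2::'a) \<noteq> 0" and P: "pencil_cubic P 0 b c d" and b: "b \<noteq> 0"
    and disc: "c\<^sup>2 - 4 * b * d = w\<^sup>2" "w \<noteq> 0"
    and good: "good_singular P {r. cubic 0 b c d r = 0}"
    and q: "q = real CARD('a)"
  shows "(3::'a) \<noteq> 0 \<Longrightarrow> p_smooth P = (q - 5) / ((q - 2) * (q - 3))"
    and "(3::'a) \<noteq> 0 \<Longrightarrow> p_valid P = (q - 5) / (q * (q - 2))"
    and "(3::'a) = 0 \<Longrightarrow> q > 3 \<Longrightarrow> p_smooth P = 1 / (q - 2)"
    and "q = 3 \<Longrightarrow> smooth_pairs P = {}"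
    and "(3::'a) = 0 \<Longrightarrow> p_valid P = (q - 3) / (q * (q - 2))"
proof -
  have k: "card {r. cubic 0 b c d r = 0} = 3"
    using card_roots_cubic[OF two b, of c d] disc by (simp add: qchar_simps)
  have D: "cubic_disc 0 b c d \<noteq> 0" using b disc by (simp add: cubic_disc_quadratic)
  note main = squarefree_pencil[OF two P D good k q]
  have q3: "q \<ge> 3" using card_odd_field[OF two] q by simp
  have q4: "q \<ge> 4" if "(3::'a) \<noteq> 0"
    using card_odd_field[OF two] q that by (cases "CARD('a) = 3") auto
  show "(3::'a) \<noteq> 0 \<Longrightarrow> p_smooth P = (q - 5) / ((q - 2) * (q - 3))"
    using main(1) q4 by simp
  show "(3::'a) \<noteq> 0 \<Longrightarrow> p_valid P = (q - 5) / (q * (q - 2))"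
    using main(2) q4 by (simp add: mult.commute)
  show "p_smooth P = 1 / (q - 2)" if "(3::'a) = 0" "q > 3"
  proof -
    have "CARD('a) \<ge> 4" using q that(2) by simp
    then have "q \<ge> 4" using q by simp
    then show ?thesis using main(1) that by simp
  qed
  show "(3::'a) = 0 \<Longrightarrow> p_valid P = (q - 3) / (q * (q - 2))"
    using main(2) q3 by (simp add: mult.commute)
  show "smooth_pairs P = {}" if "q = 3"
  proof -
    let ?S = "{r. cubic 0 b c d r \<noteq> 0}"
    have "int (card ?S) = int CARD('a) + 1 - 3"
      using card_complement_option[of "{r. cubic 0 b c d r = 0}"] by (simp add: Collect_neg_eq k)
    with that q have "card ?S = 1" by simp
    then obtain s where "?S = {s}" by (rule card_1_singletonE)
    then show ?thesis unfolding smooth_pairs_eq[OF P] pairs_from_def by auto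
  qed
qed

lemma one_root_pencil:
  fixes P :: "'a::{field,finite} pencil"
  assumes two: "(2::'a) \<noteq> 0" and P: "pencil_cubic P 0 b c d" and b: "b \<noteq> 0"
    and disc: "\<nexists>x. c\<^sup>2 - 4 * b * d = x\<^sup>2"
    and good: "good_singular P {r. cubic 0 b c d r = 0}"
    and q: "q = real CARD('a)"
  shows "p_smooth P = 1 / q" "p_valid P = (q - 1) / q\<^sup>2"
proof -
  have k: "card {r. cubic 0 b c d r = 0} = 1"
    using card_roots_cubic[OF two b, of c d] disc by (simp add: qchar_nonsquare)
  have D: "cubic_disc 0 b c d \<noteq> 0"
    using b disc neq_0_if_nonsquare[OF disc] by (simp add: cubic_disc_quadratic)
  note main = squarefree_pencil[OF two P D good k q]
  have q3: "q \<ge> 3" using card_odd_field[OF two] q by simp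
  show "p_smooth P = 1 / q" using main(1) q3 by simp
  show "p_valid P = (q - 1) / q\<^sup>2" using main(2) q3 by (simp add: power2_eq_square)
qed

lemma no_root_pencil:
  fixes P :: "'a::{field,finite} pencil"
  assumes two: "(2::'a) \<noteq> 0" and P: "pencil_cubic P a b c d"
    and noroot: "\<And>r. cubic a b c d r \<noteq> 0" and D: "cubic_disc a b c d \<noteq> 0"
    and q: "q = real CARD('a)"
  shows "p_smooth P = (if (3::'a) = 0 then 1 / (q + 1) else 1 / q)"
    "p_valid P = (if (3::'a) = 0 then 1 / (q + 1) else 1 / q)"
proof -
  have good: "good_singular P {r. cubic a b c d r = 0}"
    by (simp add: good_singular_def smooth_member[OF P] noroot)
  have k: "card {r. cubic a b c d r = 0} = 0" by (simp add: noroot)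
  note main = squarefree_pencil[OF two P D good k q]
  have q3: "q \<ge> 3" using card_odd_field[OF two] q by simp
  show "p_smooth P = (if (3::'a) = 0 then 1 / (q + 1) else 1 / q)"
    "p_valid P = (if (3::'a) = 0 then 1 / (q + 1) else 1 / q)"
    using main q3 by simp_all
qed

section \<open>The probabilities for the eleven pencils\<close>

theorem corollary3p15:
  fixes b c d e \<nu> \<rho> \<sigma> :: "'a::{field, finite}"
    and q :: real
  assumes "CHAR('a) \<noteq> 2"
    and "q = real CARD('a)"
    and "Factorial_Ring.irreducible [:1, c, b, 1:]"
    and "Factorial_Ring.irreducible [:d, 1, 1:]"
    and "Factorial_Ring.irreducible [:e, 1, 1:]"
    and "\<nexists>x. \<nu> = x\<^sup>2"
    and "\<nexists>x. \<rho>\<^sup>2 - 4 * \<nu> * \<sigma>\<^sup>2 = x\<^sup>2"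
  shows
    "(\<forall>P \<in> {pencil3, pencil16 d e}.
        (CHAR('a) \<noteq> 3 \<longrightarrow>
           p_smooth P = (q - 5) / ((q - 2) * (q - 3)) \<and>
           p_valid P = (q - 5) / (q * (q - 2))) \<and>
        (CHAR('a) = 3 \<longrightarrow>
           (q > 3 \<longrightarrow> p_smooth P = 1 / (q - 2)) \<and>
           (q = 3 \<longrightarrow> smooth_pairs P = {}) \<and>
           p_valid P = (q - 3) / (q * (q - 2)))) \<and>
     (\<forall>P \<in> {pencil4, pencil15 e}.
        (CHAR('a) \<noteq> 3 \<longrightarrow> p_smooth P = 1 / (q - 2) \<and> p_valid P = 1 / (q - 1)) \<and>
        (CHAR('a) = 3 \<longrightarrow> p_smooth P = 0 \<and> p_valid P = 0)) \<and>
     (\<forall>P \<in> {pencil5, pencil8 :: 'a pencil}.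
        (CHAR('a) \<noteq> 3 \<longrightarrow> p_smooth P = 0 \<and> p_valid P = 0) \<and>
        (CHAR('a) = 3 \<longrightarrow> p_smooth P = 1 \<and> p_valid P = 1)) \<and>
     (\<forall>P \<in> {pencil6, pencil17 e}.
        (CHAR('a) \<noteq> 3 \<longrightarrow> p_smooth P = 1 / (q - 2) \<and> p_valid P = 1 / (q - 2)) \<and>
        (CHAR('a) = 3 \<longrightarrow> p_smooth P = 0 \<and> p_valid P = 0)) \<and>
     (\<forall>P \<in> {pencil14 e, pencil19 \<nu> \<rho> \<sigma>}.
        p_smooth P = 1 / q \<and> p_valid P = (q - 1) / q\<^sup>2) \<and>
     (CHAR('a) \<noteq> 3 \<longrightarrow>
        p_smooth (pencil18 b c) = 1 / q \<and> p_valid (pencil18 b c) = 1 / q) \<and>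
     (CHAR('a) = 3 \<longrightarrow>
        p_smooth (pencil18 b c) = 1 / (q + 1) \<and> p_valid (pencil18 b c) = 1 / (q + 1))"
proof -
  have char: "Factorial_Ring.prime CHAR('a)" by (rule prime_CHAR_semidom) (rule finite_imp_CHAR_pos[OF finite])
  have two: "(2::'a) \<noteq> 0"
    using of_nat_eq_0_iff_char_dvd[where 'a = 'a, of 2] char assms(1)
    by (auto simp: primes_dvd_imp_eq)
  have three: "CHAR('a) = 3 \<longleftrightarrow> (3::'a) = 0"
    using of_nat_eq_0_iff_char_dvd[where 'a = 'a, of 3] char
    by (auto simp: primes_dvd_imp_eq)
  note pow = two_powers_neq_0[OF two] and q = assms(2)
  have d: "\<nexists>x. 1 - 4 * d = x\<^sup>2" and e: "\<nexists>x. 1 - 4 * e = x\<^sup>2"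
    using assms(4,5) nonsquare_disc_if_irreducible[OF two] by blast+
  note d0 = neq_0_if_nonsquare[OF d] and e0 = neq_0_if_nonsquare[OF e]
  have e1: "e \<noteq> 0" using e by (metis diff_zero mult_zero_right one_power2)
  have p18: "x ^ 3 + b * x\<^sup>2 + c * x + 1 \<noteq> 0" for x
    using irreducible_imp_no_root[OF assms(3), of x]
    by (simp add: algebra_simps power2_eq_square power3_eq_cube)
  have q4: "(1::'a) / 4 \<noteq> 0" "(-1::'a) / 4 \<noteq> 0" "- e / 4 \<noteq> 0" "(4 * e - 1) / 4 \<noteq> 0"
    using pow e0 e1 by auto
  have qcard: "real (card {Some (0::'a)}) = 1" "real (card ({} :: 'a option set)) = 0" by simp_all
  have disc3: "(1 / 4)\<^sup>2 - 4 * (-1/4) * 0 = (1 / 4 :: 'a)\<^sup>2" by simp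
  \<comment> \<open>The quadratic factor of the cubic of \<open>pencil16\<close> splits because the product of the two
    nonsquares \<open>1 - 4 d\<close> and \<open>1 - 4 e\<close> is a square.\<close>
  obtain w where w: "w\<^sup>2 = (1 - 4 * d) * (1 - 4 * e)"
  proof -
    have "qchar ((1 - 4 * d) * (1 - 4 * e)) = 1"
      using d e by (simp add: qchar_mult[OF two] qchar_nonsquare)
    then show thesis using that unfolding qchar_def by (metis one_neq_neg_one zero_neq_one)
  qed
  with d0 e0 have w0: "w / 4 \<noteq> 0" using pow by auto
  have disc16: "(1 / 4)\<^sup>2 - 4 * (-1/4) * ((4 * d * e - e - d) / 4) = (w / 4)\<^sup>2"
    using pow by (simp add: power_divide w field_simps)
  have disc14: "\<nexists>x. (1 / 4)\<^sup>2 - 4 * (- e / 4) * (- 1 / 4) = x\<^sup>2"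
  proof
    assume "\<exists>x. (1 / 4)\<^sup>2 - 4 * (- e / 4) * (- 1 / 4) = x\<^sup>2"
    then obtain x where "(1 / 4)\<^sup>2 - 4 * (- e / 4) * (- 1 / 4) = x\<^sup>2" ..
    moreover have "16 * ((1 / 4)\<^sup>2 - 4 * (- e / 4) * (- 1 / 4)) = 1 - 4 * e"
      using pow by (simp add: field_simps power2_eq_square)
    ultimately have "1 - 4 * e = (4 * x)\<^sup>2" by (simp add: power2_eq_square)
    with e show False by blast
  qed
  have disc19: "\<nexists>x. (-\<rho>)\<^sup>2 - 4 * (-\<nu>) * (- \<sigma>\<^sup>2) = x\<^sup>2" using assms(7) by simp
  have nu: "- \<nu> \<noteq> 0" using neq_0_if_nonsquare[OF assms(6)] by simp
  have disc18: "cubic_disc (-1/4) (-b/4) (-c/4) (-1/4) \<noteq> 0"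
    using cubic_disc_scale[of "-1/4" 1 b c 1] cubic_disc_neq_0_if_no_root[OF two p18] pow by simp
  note p3 = three_root_pencil[OF two cubic_pencil3[OF two] q4(2) disc3 q4(1) good_pencil3[OF two] q]
  note p16 = three_root_pencil[OF two cubic_pencil16[OF two] q4(2) disc16 w0 good_pencil16[OF two d0 e0] q]
  note p4 = double_root_pencil[OF two cubic_pencil4[OF two] q4(2) good_pencil4[OF two] subset_refl q]
  note p15 = double_root_pencil[OF two cubic_pencil15[OF two] q4(3) good_pencil15[OF two e1 e0] subset_refl q]
  note p5 = triple_root_pencil[OF two cubic_pencil5[OF two] q4(2) good_pencil5[OF two]]
  note p8 = triple_root_pencil[OF two cubic_pencil8[OF two] q4(2) good_pencil8[OF two]]
  note p6 = double_root_pencil[OF two cubic_pencil6[OF two] q4(2) good_pencil6[OF two] empty_subsetI q]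
  note p17 = double_root_at_infinity_pencil[OF two cubic_pencil17[OF two] q4(4) good_pencil17[OF two e0] q]
  note p14 = one_root_pencil[OF two cubic_pencil14[OF two] q4(3) disc14 good_pencil14[OF two e] q]
  note p19 = one_root_pencil[OF two cubic_pencil19[OF two] nu disc19 good_pencil19[OF two assms(6,7)] q]
  note p18 = no_root_pencil[OF two cubic_pencil18[OF two] cubic_pencil18_neq_0[OF two p18] disc18 q]
  show ?thesis
    unfolding three using p3 p16 p4 p15 p5 p8 p6 p17 p14 p19 p18 by (simp add: qcard)
qed

end
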